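(* Let $\mathfrak g$ be a Lie algebra admitting a conformally flat LCP structure $(g,\theta)$. Then $\mathfrak g$ is isomorphic to a semidirect product $\mathfrak k\ltimes\mathbb R^n$ for some $n\ge 0$, where $\mathfrak k$ is either $\mathbb R^p$ with $p\in\{1,2\}$, or $\mathfrak{su}(2)\oplus\mathbb R$. Moreover, there exist a standard conformally flat LCP structure $(g_{\mathfrak k},\theta_{\mathfrak k})$ on $\mathfrak k$ (as described in the context) and an orthogonal Lie algebra representation $\beta:\mathfrak k\to\mathfrak{so}(n)$ such that, under this isomorphism, $\mathfrak g=\mathfrak k\ltimes_\rho\mathbb R^n$ with $\rho(x)=\theta_{\mathfrak k}(x)\mathrm{Id}_n+\beta(x)$ for all $x\in\mathfrak k$, $g=g_{\mathfrak k}+\langle\cdot,\cdot\rangle_{\mathbb R^n}$ (orthogonal sum), and $\theta$ is the extension of $\theta_{\mathfrak k}$ by zero on $\mathbb R^n$.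
   Context: All Lie algebras are real and finite-dimensional. Let $\mathfrak g$ be a Lie algebra with an inner product $g$. For $x\in\mathfrak g$, $\nabla^g_x\in\mathfrak{so}(\mathfrak g)$ is given by $g(\nabla^g_xy,z)=\frac12\big(g([x,y],z)-g([x,z],y)-g([y,z],x)\big)$. For $\theta\in\mathfrak g^*$ with $g$-dual vector $\theta^\sharp$, set $\nabla^\theta_xy:=\nabla^g_xy+\theta(x)y+\theta(y)x-g(x,y)\theta^\sharp$. A 1-form $\theta\in\mathfrak g^*$ is closed if it vanishes on $\mathfrak g'=[\mathfrak g,\mathfrak g]$. A subspace $\mathfrak u\subset\mathfrak g$ is $\nabla^\theta$-flat if $\nabla^\theta_x\mathfrak u\subset\mathfrak u$ for all $x\in\mathfrak g$ and $x\mapsto\nabla^\theta_x|_{\mathfrak u}$ is a Lie algebra representation $\mathfrak g\to\mathfrak{gl}(\mathfrak u)$. An LCP structure on $\mathfrak g$ is a triple $(g,\theta,\mathfrak u)$ with $g$ an inner product, $\theta\ne0$ a closed 1-form and $\mathfrak u\neq0$ a $\nabla^\theta$-flat subspace. It is conformally flat if $\mathfrak u=\mathfrak g$, and then it is denoted $(g,\theta)$. Standard conformally flat LCP structures on $\mathfrak k$: (i) on $\mathfrak k=\mathbb R^p$, $p\in\{1,2\}$ (abelian): any inner product $g_{\mathfrak k}$ together with any non-zero $\theta_{\mathfrak k}\in(\mathbb R^p)^*$; (ii) on $\mathfrak k=\mathfrak{su}(2)\oplus\mathbb R$, with $z$ an element spanning the center and $\kappa$ the Killing form of $\mathfrak{su}(2)$: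 for parameters $\mu>0$, $\lambda\in\mathbb R\setminus\{0\}$ and $x_0\in\mathfrak{su}(2)$, the inner product $g_{\mathfrak k}=g_{\mu,\lambda}$ determined by $g_{\mu,\lambda}|_{\mathfrak{su}(2)}=-\mu\kappa$, $g_{\mu,\lambda}(z,x)=\frac{\mu}{\lambda}\kappa(x_0,x)$ for all $x\in\mathfrak{su}(2)$, and $g_{\mu,\lambda}(z,z)=\frac1{\lambda^2}\big(\frac1{8\mu}-\mu\kappa(x_0,x_0)\big)$, together with $\theta_{\mathfrak k}=g_{\mu,\lambda}(\lambda z+x_0,\cdot)$. *)

theory Defs
  imports "HOL-Analysis.Analysis" "HOL-Analysis.Finite_Function_Topology"
begin

section \<open>Linear algebra on subspaces\<close>

text \<open>Vector spaces are subspaces \<open>V\<close> of an ambient real vector space type; maps, forms and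
  brackets are total functions of which only the values on \<open>V\<close> matter.\<close>

definition linear_on :: "'a::real_vector set \<Rightarrow> ('a \<Rightarrow> 'b::real_vector) \<Rightarrow> bool" where
  "linear_on V f \<longleftrightarrow>
     (\<forall>x\<in>V. \<forall>y\<in>V. f (x + y) = f x + f y) \<and> (\<forall>c. \<forall>x\<in>V. f (c *\<^sub>R x) = c *\<^sub>R f x)"

definition bilinear_on :: "'a::real_vector set \<Rightarrow> ('a \<Rightarrow> 'a \<Rightarrow> 'b::real_vector) \<Rightarrow> bool" where
  "bilinear_on V b \<longleftrightarrow> (\<forall>x\<in>V. linear_on V (b x)) \<and> (\<forall>y\<in>V. linear_on V (\<lambda>x. b x y))"

definition inner_product_on :: "'a::real_vector set \<Rightarrow> ('a \<Rightarrow> 'a \<Rightarrow> real) \<Rightarrow> bool" where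
  "inner_product_on V g \<longleftrightarrow>
     bilinear_on V g \<and> (\<forall>x\<in>V. \<forall>y\<in>V. g x y = g y x) \<and> (\<forall>x\<in>V. x \<noteq> 0 \<longrightarrow> g x x > 0)"

text \<open>The vector of \<open>V\<close> that is \<open>g\<close>-dual to a 1-form; it exists and is unique when \<open>V\<close> is
  finite-dimensional and \<open>g\<close> is an inner product on \<open>V\<close>.\<close>

definition dual_vector :: "'a::real_vector set \<Rightarrow> ('a \<Rightarrow> 'a \<Rightarrow> real) \<Rightarrow> ('a \<Rightarrow> real) \<Rightarrow> 'a" where
  "dual_vector V g \<alpha> = (THE w. w \<in> V \<and> (\<forall>z\<in>V. g w z = \<alpha> z))"

text \<open>The trace of an endomorphism of \<open>V\<close>, computed in an arbitrary basis.\<close>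

definition trace_on :: "'a::real_vector set \<Rightarrow> ('a \<Rightarrow> 'a) \<Rightarrow> real" where
  "trace_on V f =
     (let B = (SOME B. independent B \<and> span B = V) in \<Sum>b\<in>B. representation B (f b) b)"

text \<open>Euclidean space of variable dimension \<open>n\<close>: the coordinates are indexed by \<open>{..<n}\<close>.\<close>

definition euclid :: "nat \<Rightarrow> (nat \<Rightarrow>\<^sub>0 real) set" where
  "euclid n = {v. Poly_Mapping.keys v \<subseteq> {..<n}}"

definition euclid_inner :: "nat \<Rightarrow> (nat \<Rightarrow>\<^sub>0 real) \<Rightarrow> (nat \<Rightarrow>\<^sub>0 real) \<Rightarrow> real" where
  "euclid_inner n v w = (\<Sum>i<n. Poly_Mapping.lookup v i * Poly_Mapping.lookup w i)"


section \<open>Lie algebras\<close>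

locale lie_algebra =
  fixes L :: "'a::real_vector set" and brk :: "'a \<Rightarrow> 'a \<Rightarrow> 'a"
  assumes subspace: "subspace L"
    and finite_dimensional: "\<exists>B. finite B \<and> span B = L"
    and bracket_closed: "x \<in> L \<Longrightarrow> y \<in> L \<Longrightarrow> brk x y \<in> L"
    and bracket_bilinear: "bilinear_on L brk"
    and bracket_alternating: "x \<in> L \<Longrightarrow> brk x x = 0"
    and jacobi: "x \<in> L \<Longrightarrow> y \<in> L \<Longrightarrow> z \<in> L \<Longrightarrow>
      brk x (brk y z) + brk y (brk z x) + brk z (brk x y) = 0"

definition derived_algebra :: "'a::real_vector set \<Rightarrow> ('a \<Rightarrow> 'a \<Rightarrow> 'a) \<Rightarrow> 'a set" where
  "derived_algebra L brk = span {brk x y | x y. x \<in> L \<and> y \<in> L}"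

definition lie_center :: "'a::real_vector set \<Rightarrow> ('a \<Rightarrow> 'a \<Rightarrow> 'a) \<Rightarrow> 'a set" where
  "lie_center L brk = {z \<in> L. \<forall>x\<in>L. brk z x = 0}"

definition killing_form :: "'a::real_vector set \<Rightarrow> ('a \<Rightarrow> 'a \<Rightarrow> 'a) \<Rightarrow> 'a \<Rightarrow> 'a \<Rightarrow> real" where
  "killing_form L brk x y = trace_on L (\<lambda>v. brk x (brk y v))"

definition lie_isomorphism ::
  "'a::real_vector set \<Rightarrow> ('a \<Rightarrow> 'a \<Rightarrow> 'a) \<Rightarrow> 'b::real_vector set \<Rightarrow> ('b \<Rightarrow> 'b \<Rightarrow> 'b) \<Rightarrow> ('a \<Rightarrow> 'b) \<Rightarrow> bool"
  where "lie_isomorphism L brkL M brkM \<phi> \<longleftrightarrow>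
     bij_betw \<phi> L M \<and> linear_on L \<phi> \<and> (\<forall>x\<in>L. \<forall>y\<in>L. \<phi> (brkL x y) = brkM (\<phi> x) (\<phi> y))"

definition lie_representation ::
  "'a::real_vector set \<Rightarrow> ('a \<Rightarrow> 'a \<Rightarrow> 'a) \<Rightarrow> 'v::real_vector set \<Rightarrow> ('a \<Rightarrow> 'v \<Rightarrow> 'v) \<Rightarrow> bool"
  where "lie_representation L brk U \<rho> \<longleftrightarrow>
     (\<forall>x\<in>L. linear_on U (\<rho> x) \<and> \<rho> x ` U \<subseteq> U) \<and>
     (\<forall>u\<in>U. linear_on L (\<lambda>x. \<rho> x u)) \<and>
     (\<forall>x\<in>L. \<forall>y\<in>L. \<forall>u\<in>U. \<rho> (brk x y) u = \<rho> x (\<rho> y u) - \<rho> y (\<rho> x u))"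

definition orthogonal_representation ::
  "'a::real_vector set \<Rightarrow> ('a \<Rightarrow> 'a \<Rightarrow> 'a) \<Rightarrow> nat \<Rightarrow> ('a \<Rightarrow> (nat \<Rightarrow>\<^sub>0 real) \<Rightarrow> (nat \<Rightarrow>\<^sub>0 real)) \<Rightarrow> bool"
  where "orthogonal_representation L brk n \<beta> \<longleftrightarrow>
     lie_representation L brk (euclid n) \<beta> \<and>
     (\<forall>x\<in>L. \<forall>v\<in>euclid n. \<forall>w\<in>euclid n.
        euclid_inner n (\<beta> x v) w = - euclid_inner n v (\<beta> x w))"

text \<open>The bracket of the semidirect product by an abelian ideal; the underlying vector space is
  the Cartesian product of the two carriers.\<close>

definition semidirect_bracket ::
  "('k \<Rightarrow> 'k \<Rightarrow> 'k) \<Rightarrow> ('k \<Rightarrow> 'v \<Rightarrow> 'v::real_vector) \<Rightarrow> 'k \<times> 'v \<Rightarrow> 'k \<times> 'v \<Rightarrow> 'k \<times> 'v" where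
  "semidirect_bracket brk \<rho> = (\<lambda>(x, v) (y, w). (brk x y, \<rho> x w - \<rho> y v))"


section \<open>LCP structures\<close>

definition levi_civita ::
  "'a::real_vector set \<Rightarrow> ('a \<Rightarrow> 'a \<Rightarrow> 'a) \<Rightarrow> ('a \<Rightarrow> 'a \<Rightarrow> real) \<Rightarrow> 'a \<Rightarrow> 'a \<Rightarrow> 'a" where
  "levi_civita L brk g x y =
     dual_vector L g (\<lambda>z. 1/2 * (g (brk x y) z - g (brk x z) y - g (brk y z) x))"

definition weyl_connection ::
  "'a::real_vector set \<Rightarrow> ('a \<Rightarrow> 'a \<Rightarrow> 'a) \<Rightarrow> ('a \<Rightarrow> 'a \<Rightarrow> real) \<Rightarrow> ('a \<Rightarrow> real) \<Rightarrow> 'a \<Rightarrow> 'a \<Rightarrow> 'a" where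
  "weyl_connection L brk g \<theta> x y =
     levi_civita L brk g x y + \<theta> x *\<^sub>R y + \<theta> y *\<^sub>R x - g x y *\<^sub>R dual_vector L g \<theta>"

definition closed_form :: "'a::real_vector set \<Rightarrow> ('a \<Rightarrow> 'a \<Rightarrow> 'a) \<Rightarrow> ('a \<Rightarrow> real) \<Rightarrow> bool" where
  "closed_form L brk \<theta> \<longleftrightarrow> linear_on L \<theta> \<and> (\<forall>w\<in>derived_algebra L brk. \<theta> w = 0)"

definition weyl_flat ::
  "'a::real_vector set \<Rightarrow> ('a \<Rightarrow> 'a \<Rightarrow> 'a) \<Rightarrow> ('a \<Rightarrow> 'a \<Rightarrow> real) \<Rightarrow> ('a \<Rightarrow> real) \<Rightarrow> 'a set \<Rightarrow> bool" where
  "weyl_flat L brk g \<theta> u \<longleftrightarrow>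
     subspace u \<and> u \<subseteq> L \<and> lie_representation L brk u (weyl_connection L brk g \<theta>)"

definition LCP_structure ::
  "'a::real_vector set \<Rightarrow> ('a \<Rightarrow> 'a \<Rightarrow> 'a) \<Rightarrow> ('a \<Rightarrow> 'a \<Rightarrow> real) \<Rightarrow> ('a \<Rightarrow> real) \<Rightarrow> 'a set \<Rightarrow> bool" where
  "LCP_structure L brk g \<theta> u \<longleftrightarrow>
     inner_product_on L g \<and> closed_form L brk \<theta> \<and> (\<exists>x\<in>L. \<theta> x \<noteq> 0) \<and>
     weyl_flat L brk g \<theta> u \<and> u \<noteq> {0}"

definition conformally_flat_LCP ::
  "'a::real_vector set \<Rightarrow> ('a \<Rightarrow> 'a \<Rightarrow> 'a) \<Rightarrow> ('a \<Rightarrow> 'a \<Rightarrow> real) \<Rightarrow> ('a \<Rightarrow> real) \<Rightarrow> bool" where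
  "conformally_flat_LCP L brk g \<theta> \<longleftrightarrow> LCP_structure L brk g \<theta> L"


section \<open>The standard conformally flat LCP structures\<close>

definition abelian_bracket :: "'a \<Rightarrow> 'a \<Rightarrow> 'a::real_vector" where
  "abelian_bracket x y = 0"

definition standard_abelian_LCP ::
  "nat \<Rightarrow> ((nat \<Rightarrow>\<^sub>0 real) \<Rightarrow> (nat \<Rightarrow>\<^sub>0 real) \<Rightarrow> real) \<Rightarrow> ((nat \<Rightarrow>\<^sub>0 real) \<Rightarrow> real) \<Rightarrow> bool" where
  "standard_abelian_LCP p g \<theta> \<longleftrightarrow>
     p \<in> {1, 2} \<and> inner_product_on (euclid p) g \<and>
     linear_on (euclid p) \<theta> \<and> (\<exists>x\<in>euclid p. \<theta> x \<noteq> 0)"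

definition conj_transpose :: "complex^'n^'m \<Rightarrow> complex^'m^'n" where
  "conj_transpose A = (\<chi> i j. cnj (A $ j $ i))"

definition su2 :: "(complex^2^2) set" where
  "su2 = {A. conj_transpose A = - A \<and> trace A = 0}"

definition commutator :: "complex^2^2 \<Rightarrow> complex^2^2 \<Rightarrow> complex^2^2" where
  "commutator A B = A ** B - B ** A"

definition su2_R :: "((complex^2^2) \<times> real) set" where
  "su2_R = su2 \<times> UNIV"

definition su2_R_bracket ::
  "(complex^2^2) \<times> real \<Rightarrow> (complex^2^2) \<times> real \<Rightarrow> (complex^2^2) \<times> real" where
  "su2_R_bracket = (\<lambda>(A, s) (B, t). (commutator A B, 0))"

text \<open>The values prescribed below determine \<open>g\<close> on all of \<open>su2_R\<close>, since \<open>su2_R\<close> is spanned by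
  \<open>su2 \<times> {0}\<close> and \<open>z\<close>.\<close>

definition standard_su2_R_LCP ::
  "((complex^2^2) \<times> real \<Rightarrow> (complex^2^2) \<times> real \<Rightarrow> real) \<Rightarrow> ((complex^2^2) \<times> real \<Rightarrow> real) \<Rightarrow> bool" where
  "standard_su2_R_LCP g \<theta> \<longleftrightarrow>
     (\<exists>z \<mu> lam. \<exists>x\<^sub>0\<in>su2. let \<kappa> = killing_form su2 commutator in
        lie_center su2_R su2_R_bracket = span {z} \<and> \<mu> > 0 \<and> lam \<noteq> 0 \<and>
        inner_product_on su2_R g \<and>
        (\<forall>x\<in>su2. \<forall>y\<in>su2. g (x, 0) (y, 0) = - \<mu> * \<kappa> x y) \<and>
        (\<forall>x\<in>su2. g z (x, 0) = \<mu> / lam * \<kappa> x\<^sub>0 x) \<and>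
        g z z = 1 / lam\<^sup>2 * (1 / (8 * \<mu>) - \<mu> * \<kappa> x\<^sub>0 x\<^sub>0) \<and>
        (\<forall>v\<in>su2_R. \<theta> v = g (lam *\<^sub>R z + (x\<^sub>0, 0)) v))"


section \<open>Conformally flat structures on semidirect products\<close>

definition semidirect_model ::
  "'a::real_vector set \<Rightarrow> ('a \<Rightarrow> 'a \<Rightarrow> 'a) \<Rightarrow> ('a \<Rightarrow> 'a \<Rightarrow> real) \<Rightarrow> ('a \<Rightarrow> real) \<Rightarrow>
   'k::real_vector set \<Rightarrow> ('k \<Rightarrow> 'k \<Rightarrow> 'k) \<Rightarrow> ('k \<Rightarrow> 'k \<Rightarrow> real) \<Rightarrow> ('k \<Rightarrow> real) \<Rightarrow>
   nat \<Rightarrow> ('k \<Rightarrow> (nat \<Rightarrow>\<^sub>0 real) \<Rightarrow> (nat \<Rightarrow>\<^sub>0 real)) \<Rightarrow> ('a \<Rightarrow> 'k \<times> (nat \<Rightarrow>\<^sub>0 real)) \<Rightarrow> bool" where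
  "semidirect_model L brk g \<theta> K brkK gK \<theta>K n \<beta> \<phi> \<longleftrightarrow>
     lie_isomorphism L brk (K \<times> euclid n)
       (semidirect_bracket brkK (\<lambda>x v. \<theta>K x *\<^sub>R v + \<beta> x v)) \<phi> \<and>
     (\<forall>x\<in>L. \<forall>y\<in>L. g x y = gK (fst (\<phi> x)) (fst (\<phi> y)) + euclid_inner n (snd (\<phi> x)) (snd (\<phi> y))) \<and>
     (\<forall>x\<in>L. \<theta> x = \<theta>K (fst (\<phi> x)))"

end

theory Submission
  imports Defs
begin

text \<open>
  A flat Weyl connection on the whole algebra is a product \<open>m x y = \<theta> x y + A x y\<close> with
  \<open>A\<close> a skew representation and \<open>[x,y] = m x y - m y x\<close>: the algebra acts on itself by affine
  similarities. The pure translations \<open>T\<close> form an invariant abelian ideal, and so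
  \<open>K = T\<^sup>\<bottom>\<close> is a subalgebra acting on \<open>T\<close> by similarities. On \<open>K\<close> the trace form
  \<open>B\<close> is invariant and positive definite, hence \<open>K\<close> has a central \<open>s\<close> with \<open>\<theta> s = 1\<close>, and the
  invertibility of \<open>m s\<close> gives a fixed point of the affine action, that is, a right unit \<open>e\<close>.
  The least length \<open>q v\<close> of \<open>m x v\<close> over \<open>B\<close>-unit vectors \<open>x\<close> does not change along great circles, so
  \<open>m x v = 0\<close> forces \<open>x = 0\<close> or \<open>v = 0\<close> on \<open>K\<close>. A pencil argument then shows that commuting elements
  of \<open>H = K \<inter> ker \<theta>\<close> are proportional, so that \<open>H\<close> is \<open>0\<close>, a line or \<open>su(2)\<close>. In the last case \<open>H\<close>
  with the metric induced by \<open>x \<mapsto> A x e\<close> has constant curvature, which pins the metric down.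
\<close>

section \<open>Inner products on finite-dimensional subspaces\<close>

text \<open>Freeness at \<open>e\<close> is immediate from \<open>m x e = x\<close>; the obstacle is
  to reach every other vector of \<open>K\<close>. The function \<open>q\<close> is a least
  eigenvalue, which need not be differentiable where eigenvalues cross. So it is not differentiated:
  it is compared at two points of a circle, with an error quadratic in their distance and in both
  directions, and this alone forces constancy. Behind the list of cases stands the fact that
  \<open>H\<close> acts on the sphere of \<open>K\<close>, of the same dimension, without
  infinitesimal stabilisers; only spheres of dimension 0, 1 and 3 allow this. The proof never
  integrates the action and quotes no classification of compact Lie algebras: freeness gives rank
  one, and a real root argument does the rest. Constants: put \<open>E = g e e\<close>. A basis of
  su(2) whose bracket is the cross product acts like halves of the imaginary quaternion units, so
  each basis vector has squared length \<open>E / 4\<close>. The Killing form is -2 times the dot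
  product there, whence \<mu> is \<open>E / 8\<close>. The dual vector of \<theta> on
  \<open>K\<close> is \<open>e / E\<close>, whose \<theta>-value \<open>1 / E\<close> is the
  parameter \<open>lam\<close>. The vector \<open>x0\<close> measures how far the central
  \<open>s\<close> is from being orthogonal to \<open>H\<close>.\<close>

lemma compact_box_functions:
  fixes S :: "nat \<Rightarrow> real set"
  assumes "\<And>i. compact (S i)"
  shows "compact {f. \<forall>i. f i \<in> S i}"
proof -
  have "compactin (product_topology (\<lambda>i. euclidean) UNIV) (PiE UNIV S)"
    by (subst compactin_PiE) (use assms in auto)
  then have "compact (PiE UNIV S)"
    unfolding euclidean_product_topology by simp
  moreover have "PiE UNIV S = {f. \<forall>i. f i \<in> S i}"
    by (auto simp: PiE_def Pi_def)
  ultimately show ?thesis by simp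
qed

text \<open>Forms are bilinear on the whole ambient type and only positive on \<open>V\<close>; this removes
  membership side conditions from all algebraic identities.\<close>

locale inner_space =
  fixes V :: "'a::real_vector set" and g :: "'a \<Rightarrow> 'a \<Rightarrow> real"
  assumes finite_span: "\<exists>B. finite B \<and> span B = V"
    and g_linear: "linear (g x)"
    and g_sym: "g x y = g y x"
    and g_pos: "x \<in> V \<Longrightarrow> x \<noteq> 0 \<Longrightarrow> g x x > 0"
begin

lemma subspace_V: "subspace V"
  using finite_span by auto

lemmas g_add = linear_add[OF g_linear]
  and g_scale = linear_scale[OF g_linear]
  and g_zero = linear_0[OF g_linear]
  and g_minus = linear_neg[OF g_linear]
  and g_diff = linear_diff[OF g_linear]
  and g_sum = linear_sum[OF g_linear]

lemma g_add': "g (x + y) z = g x z + g y z"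
  using g_add g_sym by metis
lemma g_scale': "g (c *\<^sub>R x) z = c * g x z"
  using g_scale g_sym by (metis real_scaleR_def)
lemma g_zero': "g 0 z = 0"
  using g_zero g_sym by metis
lemma g_minus': "g (- x) z = - g x z"
  using g_minus g_sym by metis
lemma g_diff': "g (x - y) z = g x z - g y z"
  using g_diff g_sym by metis
lemma g_sum': "g (\<Sum>i\<in>I. f i) z = (\<Sum>i\<in>I. g (f i) z)"
  by (subst g_sym) (simp add: g_sum g_sym[of z])

lemmas g_simps = g_add g_scale g_zero g_minus g_diff g_sum
  g_add' g_scale' g_zero' g_minus' g_diff' g_sum'

lemma g_nonneg: "x \<in> V \<Longrightarrow> g x x \<ge> 0"
  using g_pos[of x] by (cases "x = 0") (auto simp: g_simps)

lemma g_eq_0: "x \<in> V \<Longrightarrow> g x x = 0 \<Longrightarrow> x = 0"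
  using g_pos by force

lemma g_eqI:
  assumes "x \<in> V" "y \<in> V" "\<And>z. z \<in> V \<Longrightarrow> g x z = g y z"
  shows "x = y"
proof -
  have "x - y \<in> V"
    using assms subspace_V by (simp add: subspace_diff)
  then have "g (x - y) (x - y) = 0"
    using assms(3) by (simp add: g_diff')
  with \<open>x - y \<in> V\<close> show ?thesis
    using g_eq_0 by fastforce
qed

definition onb :: "'a set \<Rightarrow> 'a set \<Rightarrow> bool" where
  "onb B W \<longleftrightarrow> finite B \<and> B \<subseteq> V \<and> span B = W \<and>
     (\<forall>b\<in>B. \<forall>c\<in>B. g b c = (if b = c then 1 else 0))"

lemma onb_expansion:
  assumes "onb B W" "x \<in> W"
  shows "x = (\<Sum>b\<in>B. g x b *\<^sub>R b)"
proof -
  from assms obtain r where r: "x = (\<Sum>b\<in>B. r b *\<^sub>R b)"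
    unfolding onb_def using span_finite[of B] by auto
  have "g x b = r b" if "b \<in> B" for b
  proof -
    have "g x b = (\<Sum>c\<in>B. r c * g c b)" by (simp add: r g_simps)
    also have "\<dots> = (\<Sum>c\<in>B. if c = b then r c else 0)"
      by (rule sum.cong) (use assms that in \<open>auto simp: onb_def\<close>)
    finally show ?thesis using assms that by (simp add: onb_def)
  qed
  with r show ?thesis by simp
qed

lemma parseval:
  assumes "onb B W" "x \<in> W"
  shows "g x y = (\<Sum>b\<in>B. g x b * g y b)"
proof -
  have "g x y = g (\<Sum>b\<in>B. g x b *\<^sub>R b) y"
    using onb_expansion[OF assms] by simp
  then show ?thesis by (simp add: g_simps g_sym)
qed

lemma gram_schmidt:
  assumes "finite S" "S \<subseteq> V"
  shows "\<exists>B. onb B (span S)"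
  using assms
proof (induction S)
  case empty
  then show ?case by (intro exI[of _ "{}"]) (auto simp: onb_def)
next
  case (insert a S)
  then obtain B where B: "onb B (span S)" by auto
  then have fB: "finite B" and BV: "B \<subseteq> V" and sB: "span B = span S"
    and ob: "\<And>b c. b \<in> B \<Longrightarrow> c \<in> B \<Longrightarrow> g b c = (if b = c then 1 else 0)"
    by (auto simp: onb_def)
  define pr where "pr = (\<Sum>b\<in>B. g a b *\<^sub>R b)"
  define u where "u = a - pr"
  have pr: "pr \<in> span S"
    unfolding pr_def sB[symmetric] by (intro span_sum span_scale span_base)
  have uV: "u \<in> V"
    unfolding u_def pr_def using insert.prems BV subspace_V
    by (intro subspace_diff subspace_sum subspace_scale) auto
  have ortho: "g u b = 0" if "b \<in> B" for b
  proof -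
    have "g pr b = (\<Sum>c\<in>B. g a c * g c b)" by (simp add: pr_def g_simps)
    also have "\<dots> = (\<Sum>c\<in>B. if c = b then g a c else 0)"
      by (rule sum.cong) (use ob that in auto)
    finally show ?thesis using fB that by (simp add: u_def g_simps)
  qed
  have span_u: "span (insert a S) = span (insert u S)"
    unfolding span_insert
  proof safe
    fix x k assume "x - k *\<^sub>R a \<in> span S"
    then have "(x - k *\<^sub>R a) + k *\<^sub>R pr \<in> span S" by (rule span_add[OF _ span_scale[OF pr]])
    then show "\<exists>k. x - k *\<^sub>R u \<in> span S" by (intro exI[of _ k]) (simp add: u_def algebra_simps)
  next
    fix x k assume "x - k *\<^sub>R u \<in> span S"
    then have "(x - k *\<^sub>R u) - k *\<^sub>R pr \<in> span S" by (rule span_diff[OF _ span_scale[OF pr]])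
    then show "\<exists>k. x - k *\<^sub>R a \<in> span S" by (intro exI[of _ k]) (simp add: u_def algebra_simps)
  qed
  show ?case
  proof (cases "u = 0")
    case True
    then have "span (insert a S) = span S"
      using span_u by (simp add: span_insert_0)
    with B show ?thesis by auto
  next
    case False
    define c where "c = 1 / sqrt (g u u)"
    have guu: "g u u > 0" using g_pos uV False by auto
    have c: "c \<noteq> 0" "c * c * g u u = 1" using guu by (auto simp: c_def)
    have ortho': "g b u = 0" if "b \<in> B" for b using ortho[OF that] g_sym by simp
    have cu: "c *\<^sub>R u \<notin> B" using ortho[of "c *\<^sub>R u"] c guu by (auto simp: g_simps)
    have "span (insert (c *\<^sub>R u) B) = span (insert u B)"
      unfolding span_insert
    proof safe
      fix x k assume "x - k *\<^sub>R c *\<^sub>R u \<in> span B"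
      then show "\<exists>k. x - k *\<^sub>R u \<in> span B" by (intro exI[of _ "k * c"]) simp
    next
      fix x k assume "x - k *\<^sub>R u \<in> span B"
      then show "\<exists>k. x - k *\<^sub>R c *\<^sub>R u \<in> span B" using c by (intro exI[of _ "k / c"]) simp
    qed
    also have "\<dots> = span (insert u S)" by (simp add: span_insert sB)
    finally have "span (insert (c *\<^sub>R u) B) = span (insert a S)" using span_u by simp
    moreover have "g (c *\<^sub>R u) (c *\<^sub>R u) = 1" using c by (simp add: g_simps algebra_simps)
    ultimately have "onb (insert (c *\<^sub>R u) B) (span (insert a S))"
      using fB BV uV subspace_V ob cu ortho
      by (auto simp: onb_def subspace_scale g_simps ortho')
    then show ?thesis by blast
  qed
qed

lemma finite_basis:
  assumes "subspace W" "W \<subseteq> V"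
  obtains C where "finite C" "independent C" "C \<subseteq> W" "span C = W"
proof -
  obtain C where C: "C \<subseteq> W" "independent C" "W \<subseteq> span C"
    using maximal_independent_subset by blast
  from finite_span obtain D where D: "finite D" "span D = V" by auto
  have "finite C"
    using independent_span_bound[OF D(1) C(2)] C(1) D assms by auto
  moreover have "span C = W"
    using C assms by (simp add: span_minimal subset_antisym)
  ultimately show ?thesis using that C by blast
qed

lemma onb_exists:
  assumes "subspace W" "W \<subseteq> V"
  obtains B where "onb B W"
proof -
  from finite_basis[OF assms] obtain C where "finite C" "C \<subseteq> W" "span C = W" by metis
  then show ?thesis using gram_schmidt[of C] that assms by auto
qed

lemma onb_subset: "onb B W \<Longrightarrow> B \<subseteq> W"
  unfolding onb_def by (auto intro: span_base)

lemma riesz: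
  assumes "subspace W" "W \<subseteq> V" and f: "linear f"
  obtains w where "w \<in> W" "\<And>y. y \<in> W \<Longrightarrow> g w y = f y"
proof -
  obtain B where B: "onb B W" using onb_exists assms by blast
  let ?w = "\<Sum>b\<in>B. f b *\<^sub>R b"
  have "?w \<in> W" using onb_subset[OF B] assms(1)
    by (intro subspace_sum subspace_scale) auto
  moreover have "g ?w y = f y" if "y \<in> W" for y
  proof -
    have "f y = f (\<Sum>b\<in>B. g y b *\<^sub>R b)" using onb_expansion[OF B that] by simp
    also have "\<dots> = (\<Sum>b\<in>B. g y b * f b)"
      by (simp add: linear_sum[OF f] linear_scale[OF f])
    finally show ?thesis by (simp add: g_simps g_sym[of y] mult.commute)
  qed
  ultimately show ?thesis using that by blast
qed

lemma orthogonal_projection: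
  assumes "subspace W" "W \<subseteq> V"
  obtains w where "w \<in> W" "\<And>y. y \<in> W \<Longrightarrow> g (x - w) y = 0"
  using riesz[OF assms g_linear[of x]] by (metis diff_self g_diff')

lemma injective_imp_surjective:
  assumes "subspace W" "W \<subseteq> V" and f: "linear f" and "f ` W \<subseteq> W"
    and inj: "\<And>x. x \<in> W \<Longrightarrow> f x = 0 \<Longrightarrow> x = 0"
  shows "f ` W = W"
proof (rule ccontr)
  assume "f ` W \<noteq> W"
  then obtain y where y: "y \<in> W" "y \<notin> f ` W" using assms by auto
  obtain C where C: "finite C" "independent C" "C \<subseteq> W" "span C = W"
    using finite_basis assms by metis
  have inj': "inj_on f W"
    using linear_injective_on_subspace_0[OF f assms(1)] inj by auto
  have "independent (f ` C)"
    using linear_independent_injective_image[OF f C(2)] inj' C by simp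
  moreover have "y \<notin> span (f ` C)" using y C by (simp add: linear_span_image[OF f])
  ultimately have "independent (insert y (f ` C))" by (simp add: independent_insert)
  moreover have "insert y (f ` C) \<subseteq> span C" using y C(3,4) \<open>f ` W \<subseteq> W\<close> by blast
  ultimately have "card (insert y (f ` C)) \<le> card C"
    using independent_span_bound[OF C(1)] by blast
  moreover have "card (f ` C) = card C"
    using card_image inj' C inj_on_subset by metis
  moreover have "y \<notin> f ` C" using y C by auto
  ultimately show False using C by simp
qed

text \<open>The ambient type carries no topology, so the unit sphere is moved to coordinate
  functions on \<open>nat\<close>: the coordinates from \<open>n\<close> on are pinned to 0, which
  places the sphere as a closed subset of a compact box.\<close>

lemma quadratic_form_attains_min:
  assumes "subspace W" "W \<subseteq> V" "W \<noteq> {0}" and P: "\<And>x. linear (P x)" "\<And>x y. P x y = P y (x::'a) "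
  obtains v where "v \<in> W" "g v v = 1" "\<And>w. w \<in> W \<Longrightarrow> g w w = 1 \<Longrightarrow> P v v \<le> (P w w::real)"
proof -
  obtain B where B: "onb B W" using onb_exists assms by blast
  then obtain b :: "nat \<Rightarrow> 'a" and n where b: "B = b ` {..<n}" "inj_on b {..<n}"
    unfolding onb_def using finite_imp_nat_seg_image_inj_on[of B] by (metis lessThan_def)
  define vec where "vec f = (\<Sum>i<n. f i *\<^sub>R b i)" for f :: "nat \<Rightarrow> real"
  have bb: "g (b i) (b j) = (if i = j then 1 else 0)" if "i < n" "j < n" for i j
    using B b that by (auto simp: onb_def inj_on_def)
  have P': "P (x + y) z = P x z + P y z" "P (c *\<^sub>R x) z = c * P x z" for x y z c
    using P by (metis linear_add, metis linear_scale real_scaleR_def)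
  have Pz: "P 0 z = 0" for z using P'(2)[of 0 0 z] by simp
  have Psum: "P (\<Sum>i\<in>I. h i) z = (\<Sum>i\<in>I. P (h i) z)" for I :: "nat set" and h z
    by (induction I rule: infinite_finite_induct) (auto simp: P' Pz)
  have Pvec: "P (vec f) (vec f) = (\<Sum>i<n. \<Sum>j<n. f i * (f j * P (b i) (b j)))" for f
  proof -
    have "P (vec f) (vec f) = (\<Sum>i<n. f i * P (b i) (vec f))"
      by (subst vec_def) (simp add: Psum P'(2))
    also have "\<dots> = (\<Sum>i<n. \<Sum>j<n. f i * (f j * P (b i) (b j)))"
      by (simp add: vec_def linear_sum[OF P(1)] linear_scale[OF P(1)] sum_distrib_left)
    finally show ?thesis .
  qed
  have gvec: "g (vec f) (vec f) = (\<Sum>i<n. f i * f i)" for f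
  proof -
    have "g (vec f) (vec f) = (\<Sum>i<n. f i * g (b i) (vec f))"
      by (subst vec_def) (simp add: g_simps)
    also have "\<dots> = (\<Sum>i<n. \<Sum>j<n. f i * (f j * g (b i) (b j)))"
      by (simp add: vec_def g_simps sum_distrib_left)
    also have "\<dots> = (\<Sum>i<n. \<Sum>j<n. if i = j then f i * f j else 0)"
      by (intro sum.cong refl) (auto simp: bb)
    finally show ?thesis by simp
  qed
  have vecW: "vec f \<in> W" for f
    unfolding vec_def using onb_subset[OF B] assms(1) b
    by (intro subspace_sum subspace_scale) auto
  define C where "C = {f. \<forall>i. f i \<in> (if i < n then {-1..1} else {0::real})} \<inter> {f. (\<Sum>i<n. f i * f i) = 1}"
  have coord: "\<exists>f\<in>C. vec f = w" if w: "w \<in> W" "g w w = 1" for w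
  proof -
    define f where "f i = (if i < n then g w (b i) else 0)" for i
    have "w = (\<Sum>b\<in>B. g w b *\<^sub>R b)" by (rule onb_expansion[OF B w(1)])
    also have "\<dots> = vec f" by (simp add: b sum.reindex vec_def f_def)
    finally have wf: "w = vec f" .
    then have s: "(\<Sum>i<n. f i * f i) = 1" using w gvec[of f] by simp
    have "f i \<in> {-1..1}" if "i < n" for i
    proof -
      have "f i * f i \<le> (\<Sum>i<n. f i * f i)" using that by (intro member_le_sum) auto
      then have "\<bar>f i\<bar> \<le> 1" using s by (simp add: abs_square_le_1 flip: power2_eq_square)
      then show ?thesis by auto
    qed
    with s have "f \<in> C" by (auto simp: C_def f_def)
    with wf show ?thesis by blast
  qed
  have "compact C"
    unfolding C_def
    by (intro compact_Int_closed compact_box_functions closed_Collect_eq continuous_intros) auto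
  moreover have "C \<noteq> {}"
  proof -
    obtain w where w: "w \<in> W" "w \<noteq> 0" using assms subspace_0 by auto
    then have "g w w > 0" using g_pos assms by auto
    then have "g ((1 / sqrt (g w w)) *\<^sub>R w) ((1 / sqrt (g w w)) *\<^sub>R w) = 1" by (simp add: g_simps)
    with coord show ?thesis using w assms(1) subspace_scale by blast
  qed
  moreover have coordinate: "continuous_on C (\<lambda>f. f i)" for i
    by (rule continuous_on_subset[OF continuous_on_product_coordinates]) simp
  have "continuous_on C (\<lambda>f. P (vec f) (vec f))"
    unfolding Pvec by (intro continuous_intros coordinate)
  ultimately obtain f where f: "f \<in> C" "\<forall>h\<in>C. P (vec f) (vec f) \<le> P (vec h) (vec h)"
    using continuous_attains_inf[of C "\<lambda>f. P (vec f) (vec f)"] by blast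
  have "g (vec f) (vec f) = 1" using f gvec by (auto simp: C_def)
  with f coord vecW show ?thesis by (intro that[of "vec f"]) metis+
qed

text \<open>A minimiser of the Rayleigh quotient is an eigenvector of \<open>P\<close> relative to
  \<open>g\<close>, by the first variation. All spectral arguments below use only this least
  eigenvalue, with changing pairs of forms.\<close>

lemma rayleigh:
  assumes W: "subspace W" "W \<subseteq> V" "W \<noteq> {0}"
    and P: "\<And>x. linear (P x)" "\<And>x y. P x y = P y (x::'a)"
  obtains v and c :: real where "v \<in> W" "g v v = 1" "P v v = c"
    "\<And>w. w \<in> W \<Longrightarrow> P v w = c * g v w" "\<And>w. w \<in> W \<Longrightarrow> c * g w w \<le> P w w"
proof -
  obtain v where v: "v \<in> W" "g v v = 1" "\<And>w. w \<in> W \<Longrightarrow> g w w = 1 \<Longrightarrow> P v v \<le> P w w"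
    using quadratic_form_attains_min[OF W P] by blast
  have P': "P (x + y) z = P x z + P y z" "P (c *\<^sub>R x) z = c * P x z" for x y z c
    using P by (metis linear_add, metis linear_scale real_scaleR_def)
  note Ps = P' linear_add[OF P(1)] linear_scale[OF P(1)]
  have min: "P v v * g w w \<le> P w w" if w: "w \<in> W" for w
  proof (cases "w = 0")
    case True
    then show ?thesis using linear_0[OF P(1)] by (simp add: g_simps)
  next
    case False
    then have gw: "g w w > 0" using g_pos w W by auto
    have "P v v \<le> P ((1 / sqrt (g w w)) *\<^sub>R w) ((1 / sqrt (g w w)) *\<^sub>R w)"
      using gw w W by (intro v) (auto simp: g_simps subspace_scale)
    also have "\<dots> = P w w / g w w" using gw by (simp add: Ps)
    finally show ?thesis using gw by (simp add: field_simps)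
  qed
  have crit: "P v w = P v v * g v w" if w: "w \<in> W" for w
  proof (rule ccontr)
    define a where "a = P v w - P v v * g v w"
    define d where "d = P w w - P v v * g w w"
    assume "P v w \<noteq> P v v * g v w"
    then have a: "a \<noteq> 0" by (simp add: a_def)
    have d: "d \<ge> 0" using min[OF w] by (simp add: d_def)
    have q: "0 \<le> 2 * t * a + t * t * d" for t
    proof -
      have "v + t *\<^sub>R w \<in> W" using v w W by (simp add: subspace_add subspace_scale)
      from min[OF this] show ?thesis
        using v by (simp add: Ps g_simps a_def d_def algebra_simps P(2)[of w v] g_sym[of w v])
    qed
    \<comment> \<open>The vertex of the parabola would be at \<open>- a / d\<close>; the denominator
      \<open>d + 1\<close> also covers \<open>d = 0\<close> and still gives a negative
      value.\<close>
    have "0 \<le> 2 * (- a / (d + 1)) * a + (- a / (d + 1)) * (- a / (d + 1)) * d" by (rule q)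
    also have "\<dots> = - (a\<^sup>2 * (d + 2)) / (d + 1)\<^sup>2"
      using d by (simp add: divide_simps power2_eq_square) (simp add: algebra_simps)
    finally show False using a d by (simp add: divide_simps mult_le_0_iff split: if_splits)
  qed
  show ?thesis by (rule that[OF v(1,2) refl crit min])
qed

end

section \<open>Algebras of affine similarities\<close>

text \<open>The last two assumptions are \<open>\<theta> [x,y] = 0\<close> and \<open>A [x,y] = [A x, A y]\<close> for the torsion-free bracket;
  they hold on the whole ambient type once everything is precomposed with a projector onto \<open>L\<close>.\<close>

locale flat_similarity = inner_space L g for L :: "'a::real_vector set" and g +
  fixes \<theta> :: "'a \<Rightarrow> real" and A :: "'a \<Rightarrow> 'a \<Rightarrow> 'a"
  assumes theta_linear: "linear \<theta>"
    and theta_nonzero: "\<exists>x\<in>L. \<theta> x \<noteq> 0"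
    and A_linear: "linear (A x)"
    and A_linear': "linear (\<lambda>x. A x y)"
    and A_closed: "A x y \<in> L"
    and A_skew: "g (A x y) z = - g y (A x z)"
    and theta_bracket: "\<theta> (\<theta> x *\<^sub>R y + A x y - (\<theta> y *\<^sub>R x + A y x)) = 0"
    and A_bracket: "A (\<theta> x *\<^sub>R y + A x y - (\<theta> y *\<^sub>R x + A y x)) z = A x (A y z) - A y (A x z)"
begin

definition m :: "'a \<Rightarrow> 'a \<Rightarrow> 'a" where "m x y = \<theta> x *\<^sub>R y + A x y"
definition br :: "'a \<Rightarrow> 'a \<Rightarrow> 'a" where "br x y = m x y - m y x"

lemmas theta_simps = linear_add[OF theta_linear] linear_scale[OF theta_linear] linear_0[OF theta_linear]
  linear_neg[OF theta_linear] linear_diff[OF theta_linear] linear_sum[OF theta_linear]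

lemmas A_simps = linear_add[OF A_linear] linear_scale[OF A_linear] linear_0[OF A_linear]
  linear_neg[OF A_linear] linear_diff[OF A_linear] linear_sum[OF A_linear]
  linear_add[OF A_linear'] linear_scale[OF A_linear'] linear_0[OF A_linear']
  linear_neg[OF A_linear'] linear_diff[OF A_linear'] linear_sum[OF A_linear']

lemma m_linear: "linear (m x)"
  by (rule linearI) (auto simp: m_def A_simps algebra_simps)

lemma m_linear': "linear (\<lambda>x. m x y)"
  by (rule linearI) (auto simp: m_def A_simps theta_simps algebra_simps)

lemmas m_simps = linear_add[OF m_linear] linear_scale[OF m_linear] linear_0[OF m_linear]
  linear_neg[OF m_linear] linear_diff[OF m_linear] linear_sum[OF m_linear]
  linear_add[OF m_linear'] linear_scale[OF m_linear'] linear_0[OF m_linear']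
  linear_neg[OF m_linear'] linear_diff[OF m_linear'] linear_sum[OF m_linear']

lemma br_linear: "linear (br x)"
  by (rule linearI) (auto simp: br_def m_simps algebra_simps)

lemma br_linear': "linear (\<lambda>x. br x y)"
  by (rule linearI) (auto simp: br_def m_simps algebra_simps)

lemmas br_simps = linear_add[OF br_linear] linear_scale[OF br_linear] linear_0[OF br_linear]
  linear_neg[OF br_linear] linear_diff[OF br_linear]
  linear_add[OF br_linear'] linear_scale[OF br_linear'] linear_0[OF br_linear']
  linear_neg[OF br_linear'] linear_diff[OF br_linear']

lemma br_anti: "br y x = - br x y" by (simp add: br_def)
lemma br_self: "br x x = 0" by (simp add: br_def)

lemma theta_br: "\<theta> (br x y) = 0"
  using theta_bracket by (simp add: br_def m_def)

lemma A_br: "A (br x y) z = A x (A y z) - A y (A x z)"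
  using A_bracket by (simp add: br_def m_def)

lemma m_br: "m (br x y) z = m x (m y z) - m y (m x z)"
  by (simp add: m_def[of "br x y"] theta_br A_br) (simp add: m_def A_simps algebra_simps)

text \<open>First Bianchi identity: the commutator of a flat torsion-free (left-symmetric) product
  is a Lie bracket. It holds on the whole type, like the axioms of the locale.\<close>

lemma jacobi: "br x (br y z) + br y (br z x) + br z (br x y) = 0"
proof -
  have "br x (br y z) + br y (br z x) + br z (br x y) =
      m x (br y z) + m y (br z x) + m z (br x y) - (m (br y z) x + m (br z x) y + m (br x y) z)"
    by (simp add: br_def[of _ "br _ _"])
  also have "\<dots> = 0"
    by (simp only: m_br) (simp add: br_def m_simps)
  finally show ?thesis .
qed

lemma g_A_self: "g (A x y) y = 0"
  using A_skew[of x y y] g_sym[of y "A x y"] by simp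

lemma g_A_self': "g y (A x y) = 0"
  using g_A_self g_sym by simp

lemma g_m_self: "g (m x y) y = \<theta> x * g y y"
  by (simp add: m_def g_simps g_A_self)

lemma g_m_m: "g (m x y) (m x y) = (\<theta> x)\<^sup>2 * g y y + g (A x y) (A x y)"
  using g_A_self[of x y] g_A_self'[of y x] by (simp add: m_def g_simps power2_eq_square)

section \<open>The ideal of translations and its orthogonal complement\<close>

definition T :: "'a set" where "T = {x \<in> L. \<theta> x = 0 \<and> (\<forall>y\<in>L. A x y = 0)}"
definition K :: "'a set" where "K = {x \<in> L. \<forall>t\<in>T. g x t = 0}"

lemma subspace_T: "subspace T"
  unfolding T_def using subspace_V
  by (auto simp: subspace_def theta_simps A_simps)

lemma subspace_K: "subspace K"
  unfolding K_def using subspace_V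
  by (auto simp: subspace_def g_simps)

lemma T_subset: "T \<subseteq> L" and K_subset: "K \<subseteq> L"
  by (auto simp: T_def K_def)

lemma K_finite: "\<exists>B. finite B \<and> span B = K"
  using finite_basis[OF subspace_K K_subset] by metis

lemma m_closed: "y \<in> L \<Longrightarrow> m x y \<in> L"
  unfolding m_def using subspace_V A_closed by (simp add: subspace_add subspace_scale)

text \<open>Since \<open>m t x = 0\<close>, the bracket of \<open>x\<close> and \<open>t\<close> is
  \<open>m x t\<close>. Both \<theta> and \<open>A\<close> are compatible with brackets and vanish
  on \<open>t\<close>, hence on this bracket, and so on \<open>A x t\<close>.\<close>

lemma A_T: "x \<in> L \<Longrightarrow> t \<in> T \<Longrightarrow> A x t \<in> T"
proof -
  assume x: "x \<in> L" and t: "t \<in> T"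
  have b: "br x t = \<theta> x *\<^sub>R t + A x t"
    using x t by (simp add: br_def m_def T_def)
  have "\<theta> (A x t) = 0"
    using theta_br[of x t] t by (simp add: b theta_simps T_def)
  moreover have "A (A x t) y = 0" if "y \<in> L" for y
    using A_br[of x t y] t that A_closed by (simp add: b A_simps T_def)
  ultimately show ?thesis using A_closed by (simp add: T_def)
qed

lemma A_K: "x \<in> L \<Longrightarrow> y \<in> K \<Longrightarrow> A x y \<in> K"
  using A_T A_closed A_skew by (fastforce simp: K_def)

lemma m_K: "x \<in> L \<Longrightarrow> y \<in> K \<Longrightarrow> m x y \<in> K"
  unfolding m_def using subspace_K A_K by (simp add: subspace_add subspace_scale)

lemma br_K: "x \<in> K \<Longrightarrow> y \<in> K \<Longrightarrow> br x y \<in> K"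
  unfolding br_def using subspace_K K_subset m_K by (auto intro!: subspace_diff)

lemma K_T_decomposition:
  assumes "x \<in> L"
  obtains k t where "k \<in> K" "t \<in> T" "x = k + t"
proof -
  obtain t where t: "t \<in> T" "\<And>y. y \<in> T \<Longrightarrow> g (x - t) y = 0"
    using orthogonal_projection[OF subspace_T T_subset] by blast
  then have "x - t \<in> K"
    using assms T_subset subspace_V by (auto simp: K_def subspace_diff)
  then show ?thesis using that[of "x - t" t] t by simp
qed

section \<open>The invariant form, the central element and the right unit\<close>

definition Lb :: "'a set" where "Lb = (SOME B. onb B L)"

lemma Lb: "onb Lb L"
  unfolding Lb_def using onb_exists[OF subspace_V order_refl] by (metis someI_ex)

text \<open>Minus the trace form of \<open>A\<close>, by skewness, plus the square of \<theta>. The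
  sum runs over a basis of all of \<open>L\<close>, so that the null vectors are exactly the
  elements of \<open>T\<close>, up to the part outside \<open>L\<close>. With this weight of
  \<theta> the map \<open>m x\<close> does not increase lengths when
  \<open>B x x = 1\<close>.\<close>

definition B :: "'a \<Rightarrow> 'a \<Rightarrow> real" where
  "B x y = \<theta> x * \<theta> y + (\<Sum>b\<in>Lb. g (A x b) (A y b))"

text \<open>The tensor formed by the sum of \<open>b\<close> times \<open>b\<close> over an
  orthonormal basis is invariant under every skew map. This is what makes the trace form
  invariant.\<close>

lemma skew_transfer:
  assumes S: "\<And>x y. g (S x) y = - g x (S y)" and "\<And>x. S x \<in> L"
    and beta: "\<And>x. linear (\<beta> x)" "\<And>y. linear (\<lambda>x. \<beta> x y)"
  shows "(\<Sum>b\<in>Lb. \<beta> (S b) b + \<beta> b (S b)) = (0::real)"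
proof -
  have 1: "\<beta> (S b) b = (\<Sum>c\<in>Lb. g (S b) c * \<beta> c b)" for b
  proof -
    have "\<beta> (S b) b = \<beta> (\<Sum>c\<in>Lb. g (S b) c *\<^sub>R c) b"
      using onb_expansion[OF Lb assms(2)] by simp
    then show ?thesis by (simp add: linear_sum[OF beta(2)] linear_scale[OF beta(2)])
  qed
  have 2: "\<beta> b (S b) = (\<Sum>c\<in>Lb. g (S b) c * \<beta> b c)" for b
  proof -
    have "\<beta> b (S b) = \<beta> b (\<Sum>c\<in>Lb. g (S b) c *\<^sub>R c)"
      using onb_expansion[OF Lb assms(2)] by simp
    then show ?thesis by (simp add: linear_sum[OF beta(1)] linear_scale[OF beta(1)])
  qed
  have "(\<Sum>b\<in>Lb. \<beta> b (S b)) = (\<Sum>b\<in>Lb. \<Sum>c\<in>Lb. g (S c) b * \<beta> c b)"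
    unfolding 2 by (rule sum.swap)
  also have "\<dots> = - (\<Sum>b\<in>Lb. \<beta> (S b) b)"
    unfolding 1 sum_negf[symmetric] by (intro sum.cong refl) (metis S g_sym mult_minus_left)
  finally show ?thesis by (simp add: sum.distrib)
qed

lemma B_linear: "linear (B x)"
  by (rule linearI)
     (auto simp: B_def theta_simps A_simps g_simps algebra_simps sum.distrib sum_distrib_left)

lemma B_sym: "B x y = B y x"
  by (simp add: B_def g_sym mult.commute)

text \<open>The operator norm is at most the Hilbert-Schmidt norm: Cauchy-Schwarz over the basis,
  then in each summand, after which one factor \<open>g (A x y) (A x y)\<close> cancels.\<close>

lemma A_bound:
  assumes "y \<in> L"
  shows "g (A x y) (A x y) \<le> g y y * (\<Sum>b\<in>Lb. g (A x b) (A x b))"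
proof -
  let ?c = "A x y"
  have cauchy: "(g v w)\<^sup>2 \<le> g v v * g w w" if "v \<in> L" "w \<in> L" for v w
    unfolding parseval[OF Lb that(1), of w] parseval[OF Lb that(1), of v] parseval[OF Lb that(2), of w]
    using Cauchy_Schwarz_ineq_sum[of "g v" "g w" Lb] by (simp add: power2_eq_square)
  have nn: "g (A x b) (A x b) \<ge> 0" for b using g_nonneg A_closed by blast
  have "?c = A x (\<Sum>b\<in>Lb. g y b *\<^sub>R b)" using onb_expansion[OF Lb assms] by simp
  then have "?c = (\<Sum>b\<in>Lb. g y b *\<^sub>R A x b)" by (simp add: A_simps)
  then have "g ?c ?c = (\<Sum>b\<in>Lb. g y b * g (A x b) ?c)"
    by (metis (no_types, lifting) g_scale' g_sum' sum.cong)
  then have "(g ?c ?c)\<^sup>2 \<le> (\<Sum>b\<in>Lb. (g y b)\<^sup>2) * (\<Sum>b\<in>Lb. (g (A x b) ?c)\<^sup>2)"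
    using Cauchy_Schwarz_ineq_sum[of "g y" "\<lambda>b. g (A x b) ?c" Lb] by simp
  also have "(\<Sum>b\<in>Lb. (g y b)\<^sup>2) = g y y"
    using parseval[OF Lb assms, of y] by (simp add: power2_eq_square)
  also have "g y y * (\<Sum>b\<in>Lb. (g (A x b) ?c)\<^sup>2) \<le> g y y * (\<Sum>b\<in>Lb. g (A x b) (A x b) * g ?c ?c)"
    by (intro mult_left_mono sum_mono cauchy A_closed g_nonneg assms)
  also have "\<dots> = (g y y * (\<Sum>b\<in>Lb. g (A x b) (A x b))) * g ?c ?c"
    by (simp add: sum_distrib_right)
  finally have le: "g ?c ?c * g ?c ?c \<le> (g y y * (\<Sum>b\<in>Lb. g (A x b) (A x b))) * g ?c ?c"
    by (simp add: power2_eq_square)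
  show ?thesis
  proof (cases "g ?c ?c = 0")
    case True
    then show ?thesis using g_nonneg[OF assms] nn by (simp add: sum_nonneg)
  next
    case False
    then have "g ?c ?c > 0" using nn[of y] by simp
    with le show ?thesis by simp
  qed
qed

lemma m_bound: "y \<in> L \<Longrightarrow> g (m x y) (m x y) \<le> B x x * g y y"
  using A_bound[of y x] by (simp add: g_m_m B_def power2_eq_square algebra_simps)

lemma B_pos:
  assumes "x \<in> K" "x \<noteq> 0"
  shows "B x x > 0"
proof (rule ccontr)
  have nn: "g (A x b) (A x b) \<ge> 0" for b using g_nonneg A_closed by blast
  assume "\<not> B x x > 0"
  then have "B x x = 0"
    using nn by (simp add: B_def sum_nonneg add_nonneg_nonneg antisym linorder_not_less)
  then have "\<theta> x * \<theta> x = 0" "(\<Sum>b\<in>Lb. g (A x b) (A x b)) = 0"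
    using nn by (auto simp: B_def add_nonneg_eq_0_iff sum_nonneg)
  then have t: "\<theta> x = 0" and "\<And>y. y \<in> L \<Longrightarrow> g (A x y) (A x y) \<le> 0"
    using A_bound[of _ x] by auto
  then have "A x y = 0" if "y \<in> L" for y
    using g_pos[OF A_closed, of x y] that by (metis linorder_not_less)
  with t assms have "x \<in> T" using K_subset by (auto simp: T_def)
  then have "g x x = 0" using assms by (auto simp: K_def)
  then show False using assms K_subset g_eq_0 by blast
qed

lemma B_invariant: "B (br x y) z = - B y (br x z)"
proof -
  have *: "(\<Sum>b\<in>Lb. g (A y (A x b)) (A z b) + g (A y b) (A z (A x b))) = 0"
    using A_skew A_closed
    by (intro skew_transfer[where \<beta>="\<lambda>u v. g (A y u) (A z v)"])
       (auto intro!: linearI simp: A_simps g_simps)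
  have "B (br x y) z + B y (br x z) =
     (\<Sum>b\<in>Lb. g (A x (A y b)) (A z b) + g (A y b) (A x (A z b))
        - (g (A y (A x b)) (A z b) + g (A y b) (A z (A x b))))"
    by (simp add: B_def theta_br A_br g_simps sum.distrib sum_subtractf)
  also have "\<dots> = (\<Sum>b\<in>Lb. - (g (A y (A x b)) (A z b) + g (A y b) (A z (A x b))))"
    by (intro sum.cong refl) (simp add: A_skew[of x "A y _"])
  also have "\<dots> = 0" unfolding sum_negf * by simp
  finally show ?thesis by simp
qed

text \<open>Two inner products live on \<open>K\<close>: \<open>B\<close> is invariant and serves
  the Lie algebra, \<open>g\<close> is the given metric and serves the geometry.\<close>

sublocale KB: inner_space K B
  by (intro inner_space.intro K_finite B_linear B_sym B_pos)

sublocale Kg: inner_space K g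
  by (intro inner_space.intro K_finite g_linear g_sym g_pos) (use K_subset in auto)

text \<open>The \<open>B\<close>-dual of \<theta> on \<open>K\<close> is central: by invariance its
  bracket with \<open>x\<close>, paired with \<open>y\<close>, is \<theta> of a bracket. It is
  nonzero because \<theta> vanishes on \<open>T\<close> and so not on \<open>K\<close>, and
  \<open>\<theta> s = B s s\<close> allows rescaling.\<close>

lemma central_element:
  obtains s where "s \<in> K" "\<theta> s = 1" "\<And>x. x \<in> K \<Longrightarrow> br s x = 0"
proof -
  obtain s where s: "s \<in> K" "\<And>y. y \<in> K \<Longrightarrow> B s y = \<theta> y"
    using KB.riesz[OF subspace_K order_refl theta_linear] by blast
  obtain x k t where "x \<in> L" "\<theta> x \<noteq> 0" "k \<in> K" "t \<in> T" "x = k + t"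
    using theta_nonzero K_T_decomposition by metis
  then have "\<theta> k \<noteq> 0" by (simp add: T_def theta_simps)
  then have "s \<noteq> 0" using s(2)[OF \<open>k \<in> K\<close>] by (auto simp: KB.g_simps)
  then have pos: "\<theta> s > 0" using s B_pos by metis
  have central: "br s x = 0" if x: "x \<in> K" for x
  proof (rule KB.g_eqI)
    fix y assume y: "y \<in> K"
    have "B (br s x) y = - B (br x s) y" by (simp add: br_anti[of x s] KB.g_simps)
    also have "\<dots> = B s (br x y)" by (simp add: B_invariant)
    also have "\<dots> = 0" using s x y br_K theta_br by simp
    finally show "B (br s x) y = B 0 y" by (simp add: KB.g_simps)
  qed (use s x br_K subspace_K subspace_0 in auto)
  show ?thesis
  proof (rule that[of "(1 / \<theta> s) *\<^sub>R s"])
    show "(1 / \<theta> s) *\<^sub>R s \<in> K" using s subspace_K subspace_scale by blast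
    show "\<theta> ((1 / \<theta> s) *\<^sub>R s) = 1" using pos by (simp add: theta_simps)
    show "br ((1 / \<theta> s) *\<^sub>R s) x = 0" if "x \<in> K" for x
      using central[OF that] by (simp add: br_simps)
  qed
qed

lemma m_inj: "y \<in> L \<Longrightarrow> \<theta> x \<noteq> 0 \<Longrightarrow> m x y = 0 \<Longrightarrow> y = 0"
  using g_m_self[of x y] g_eq_0 by (auto simp: g_simps)

text \<open>A fixed point of the central \<open>s\<close> is fixed by everything that commutes with
  \<open>s\<close>: centrality gives \<open>m x s = m s x\<close>, so \<open>m x e - x\<close> lies
  in the kernel of \<open>m s\<close>, which is trivial as \<open>\<theta> s = 1\<close>.\<close>

lemma right_unit:
  obtains e where "e \<in> K" "\<And>x. x \<in> K \<Longrightarrow> m x e = x"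
proof -
  obtain s where s: "s \<in> K" "\<theta> s = 1" "\<And>x. x \<in> K \<Longrightarrow> br s x = 0"
    using central_element by blast
  have sL: "s \<in> L" using s K_subset by auto
  have "m s ` K = K"
    using m_K[OF sL] m_inj[of _ s] s K_subset
    by (intro Kg.injective_imp_surjective subspace_K m_linear) auto
  then obtain e where e: "e \<in> K" "m s e = s" using s(1) by (metis imageE)
  have "m x e = x" if x: "x \<in> K" for x
  proof -
    have "m s (m x e) = m x (m s e) + m (br s x) e" by (simp add: m_br)
    also have "\<dots> = m x s" using e s x by (simp add: m_simps)
    also have "\<dots> = m s x" using s(3)[OF x] by (simp add: br_def)
    finally have "m s (m x e - x) = 0" by (simp add: m_simps)
    moreover have "m x e - x \<in> L"
      using x e K_subset m_closed subspace_V by (meson subsetD subspace_diff)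
    ultimately show ?thesis using m_inj[of _ s] s by fastforce
  qed
  with e show ?thesis using that by blast
qed

text \<open>If \<open>q > 0\<close> then \<open>u = m x v\<close> for some \<open>x\<close> with \<open>\<theta> x = 0\<close>, and the first order term vanishes because
  the minimiser satisfies \<open>B z [z,x] = 0\<close>. If \<open>q = 0\<close> then \<open>m z v = 0\<close>.\<close>

lemma minimal_length_step:
  assumes v: "v \<in> K" and z: "z \<in> K" "B z z = 1"
    and crit: "\<And>y. y \<in> K \<Longrightarrow> g (m z v) (m y v) = q * B z y"
    and min: "\<And>y. y \<in> K \<Longrightarrow> q * B y y \<le> g (m y v) (m y v)"
    and u: "u \<in> K" "g u v = 0"
  shows "g (m z (v + u)) (m z (v + u)) \<le> q + g u u"
proof -
  have vL: "v \<in> L" and uL: "u \<in> L" using u v K_subset by auto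
  have q: "g (m z v) (m z v) = q" using crit[OF z(1)] z(2) by simp
  have cross: "g (m z v) (m z u) = 0"
  proof (cases "q = 0")
    case True
    then have "m z v = 0" using q g_eq_0 m_closed vL by blast
    then show ?thesis by (simp add: g_simps)
  next
    case False
    then have qpos: "q > 0" using q g_nonneg[OF m_closed[OF vL, of z]] by simp
    have "x = 0" if "x \<in> K" "m x v = 0" for x
      using min[OF that(1)] that B_pos[of x] qpos by (auto simp: g_simps mult_le_0_iff)
    then have "(\<lambda>x. m x v) ` K = K"
      using m_K v K_subset by (intro Kg.injective_imp_surjective subspace_K m_linear') auto
    then obtain x where x: "x \<in> K" "m x v = u" using u by (metis (no_types, lifting) imageE)
    have "\<theta> x * g v v = 0" using g_m_self[of x v] x u by simp
    then have tx: "\<theta> x = 0 \<or> v = 0" using g_eq_0 vL by auto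
    have "g (m z v) (m z u) = g (m z v) (m x (m z v)) + g (m z v) (m (br z x) v)"
      unfolding x(2)[symmetric] by (simp add: m_br g_simps)
    also have "g (m z v) (m x (m z v)) = \<theta> x * g (m z v) (m z v)"
      using g_m_self[of x "m z v"] by (simp add: g_sym)
    also have "\<dots> = 0" using tx by (auto simp: m_simps g_simps)
    also have "g (m z v) (m (br z x) v) = q * B z (br z x)"
      using crit br_K z x by simp
    also have "B z (br z x) = 0"
      using B_invariant[of z z x] by (simp add: br_self KB.g_simps)
    finally show ?thesis by simp
  qed
  have "g (m z (v + u)) (m z (v + u)) = q + g (m z u) (m z u)"
    using cross cross[unfolded g_sym[of "m z v"]] q by (simp add: m_simps g_simps)
  also have "\<dots> \<le> q + g u u" using m_bound[OF uL, of z] z by simp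
  finally show ?thesis .
qed

end

section \<open>Fixed-point freeness and the kernel of the 1-form\<close>

text \<open>Exchanging \<open>s\<close> and \<open>t\<close> makes the bound two-sided, so every
  difference quotient tends to 0. Differentiability is a conclusion here, which is why the lemma
  applies to a least eigenvalue.\<close>

lemma quadratic_oscillation_imp_constant:
  fixes f :: "real \<Rightarrow> real"
  assumes "\<And>s t. f s \<le> f t + C * (s - t)\<^sup>2"
  shows "f s = f t"
proof -
  have "(f has_real_derivative 0) (at x)" for x
  proof -
    have "((\<lambda>h. (f (x + h) - f x) / h) \<longlongrightarrow> 0) (at 0)"
    proof (rule Lim_null_comparison)
      show "\<forall>\<^sub>F h in at 0. norm ((f (x + h) - f x) / h) \<le> C * \<bar>h\<bar>"
      proof (rule eventually_at_filter[THEN iffD2], rule always_eventually, safe)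
        fix h :: real assume h: "h \<noteq> 0"
        have "\<bar>f (x + h) - f x\<bar> \<le> C * h\<^sup>2"
          using assms[of "x + h" x] assms[of x "x + h"] by (simp add: power2_commute abs_le_iff)
        then show "norm ((f (x + h) - f x) / h) \<le> C * \<bar>h\<bar>"
          using h by (simp add: divide_simps power2_eq_square abs_mult flip: abs_mult)
      qed
      show "((\<lambda>h. C * \<bar>h\<bar>) \<longlongrightarrow> 0) (at 0)"
        by (rule tendsto_eq_intros refl | simp)+
    qed
    then show ?thesis by (simp add: DERIV_def)
  qed
  then show ?thesis using DERIV_isconst_all by blast
qed

context flat_similarity
begin

lemma K_simps: "x \<in> K \<Longrightarrow> y \<in> K \<Longrightarrow> x + y \<in> K" "x \<in> K \<Longrightarrow> y \<in> K \<Longrightarrow> x - y \<in> K"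
  "x \<in> K \<Longrightarrow> c *\<^sub>R x \<in> K" "x \<in> K \<Longrightarrow> - x \<in> K" "0 \<in> K" "x \<in> K \<Longrightarrow> x \<in> L"
  using subspace_K K_subset
  by (auto simp: subspace_add subspace_diff subspace_scale subspace_neg subspace_0)

text \<open>The positive value \<open>q e\<close>, which comes from \<open>m x e = x\<close>, is
  carried along the great circle from \<open>e\<close> to the direction of \<open>v\<close>; a
  nonzero \<open>x\<close> with \<open>m x v = 0\<close> would make \<open>q v\<close> at most
  0.\<close>

lemma m_faithful:
  assumes v: "v \<in> K" "v \<noteq> 0" and x: "x \<in> K" "m x v = 0"
  shows "x = 0"
proof (rule ccontr)
  assume x0: "x \<noteq> 0"
  then have K0: "K \<noteq> {0}" using x by auto
  obtain e where e: "e \<in> K" "\<And>x. x \<in> K \<Longrightarrow> m x e = x" using right_unit by blast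
  define E where "E = g e e"
  have e0: "e \<noteq> 0" using e(2)[OF x(1)] x0 by (auto simp: m_simps)
  have E: "E > 0" unfolding E_def using Kg.g_pos e(1) e0 by blast
  \<comment> \<open>For each \<open>v\<close>, the \<open>B\<close>-unit eigenvector
    \<open>z\<close> and the least eigenvalue \<open>q\<close> of the form that pairs
    \<open>m y v\<close> with \<open>m z v\<close>.\<close>
  have "\<exists>z q. z \<in> K \<and> B z z = 1 \<and> (\<forall>y\<in>K. g (m z v) (m y v) = q * B z y)
      \<and> (\<forall>y\<in>K. q * B y y \<le> g (m y v) (m y v))" for v
  proof (rule KB.rayleigh[OF subspace_K order_refl K0, of "\<lambda>y z. g (m y v) (m z v)"])
    show "linear (\<lambda>z. g (m y v) (m z v))" for y
      by (rule linearI) (auto simp: m_simps g_simps)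
    show "g (m y v) (m z v) = g (m z v) (m y v)" for y z by (rule g_sym)
  next
    fix z c assume "z \<in> K" "B z z = 1" "\<And>y. y \<in> K \<Longrightarrow> g (m z v) (m y v) = c * B z y"
      "\<And>y. y \<in> K \<Longrightarrow> c * B y y \<le> g (m y v) (m y v)"
    then show ?thesis by blast
  qed
  then obtain Z q where Zq: "\<And>v. Z v \<in> K" "\<And>v. B (Z v) (Z v) = 1"
      "\<And>v y. y \<in> K \<Longrightarrow> g (m (Z v) v) (m y v) = q v * B (Z v) y"
      "\<And>v y. y \<in> K \<Longrightarrow> q v * B y y \<le> g (m y v) (m y v)"
    by metis
  have qZ: "g (m (Z v) v) (m (Z v) v) = q v" for v
    using Zq(3)[OF Zq(1), of v v] Zq(2) by simp
  have q_step: "q (v + u) \<le> q v + g u u" if "v \<in> K" "u \<in> K" "g u v = 0" for v u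
  proof -
    have "q (v + u) \<le> g (m (Z v) (v + u)) (m (Z v) (v + u))"
      using Zq(4)[OF Zq(1), of "v + u" v] Zq(2) by simp
    also have "\<dots> \<le> q v + g u u"
      using that Zq by (intro minimal_length_step) auto
    finally show ?thesis .
  qed
  have q_scale: "q (c *\<^sub>R v) \<le> c\<^sup>2 * q v" for c v
    using Zq(4)[OF Zq(1), of "c *\<^sub>R v" v] Zq(2) qZ[of v]
    by (simp add: m_simps g_simps power2_eq_square)
  have q_nonneg: "q v \<ge> 0" if "v \<in> K" for v
    using qZ[of v] g_nonneg[OF m_closed, of v "Z v"] that K_simps by auto
  have qe: "q e > 0"
  proof -
    have "q e = g (Z e) (Z e)" using qZ[of e] e(2) Zq(1) by simp
    moreover have "Z e \<noteq> 0" using Zq(2)[of e] by (auto simp: KB.g_simps)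
    ultimately show ?thesis using g_pos Zq(1) K_simps by metis
  qed
  have qv: "q v \<le> 0"
    using Zq(4)[OF x(1), of v] x B_pos[OF x(1) x0] by (simp add: g_simps mult_le_0_iff)
  \<comment> \<open>The part of \<open>v\<close> orthogonal to \<open>e\<close>. If it vanished,
    \<open>v\<close> would be a multiple of \<open>e\<close> and \<open>m x v = 0\<close> would give
    \<open>x = 0\<close> at once.\<close>
  define w where "w = v - (g v e / E) *\<^sub>R e"
  have w: "w \<in> K" "g w e = 0"
    using v e E by (auto simp: w_def K_simps g_simps E_def)
  have "w \<noteq> 0"
  proof
    assume "w = 0"
    then have "v = (g v e / E) *\<^sub>R e" by (simp add: w_def)
    then have "(g v e / E) *\<^sub>R x = 0" using x(2) e(2)[OF x(1)] by (metis m_simps(2))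
    then show False using x0 v \<open>v = _\<close> by auto
  qed
  then have gw: "g w w > 0" using w g_pos K_simps by auto
  \<comment> \<open>Chosen so that \<open>f\<close> has the same length as \<open>e\<close>;
    otherwise the curve below would be an ellipse, with a tangent not orthogonal to its
    position.\<close>
  define b where "b = sqrt (g w w / E)"
  have b: "b > 0" "b * b * E = g w w" using gw E by (auto simp: b_def)
  define f where "f = (1 / b) *\<^sub>R w"
  have f: "f \<in> K" "g f e = 0" "g e f = 0" "g f f = E"
    using w b by (auto simp: f_def K_simps g_simps g_sym[of e w] field_simps)
  define a where "a = g v e / E"
  have vab: "v = a *\<^sub>R e + b *\<^sub>R f" using b by (simp add: a_def f_def w_def)
  define r where "r = sqrt (a\<^sup>2 + b\<^sup>2)"
  have r: "r > 0" "r\<^sup>2 = a\<^sup>2 + b\<^sup>2"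
    using b by (auto simp: r_def intro!: add_nonneg_pos)
  have "(a / r)\<^sup>2 + (b / r)\<^sup>2 = 1" 
    using r(1) by (simp add: power_divide flip: add_divide_distrib r(2))
  then obtain t where t: "a / r = cos t" "b / r = sin t" using sincos_total_2pi by metis
  define \<gamma> where "\<gamma> t = cos t *\<^sub>R e + sin t *\<^sub>R f" for t
  define \<gamma>' where "\<gamma>' t = cos t *\<^sub>R f - sin t *\<^sub>R e" for t
  have gK: "\<gamma> t \<in> K" "\<gamma>' t \<in> K" for t using e f by (auto simp: \<gamma>_def \<gamma>'_def K_simps)
  have gg: "g (\<gamma>' t) (\<gamma> t) = 0" "g (\<gamma>' t) (\<gamma>' t) = E" for t
    using f sin_cos_squared_add3[of t]
    by (auto simp: \<gamma>_def \<gamma>'_def g_simps E_def[symmetric] algebra_simps simp flip: distrib_left)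
  \<comment> \<open>In the orthogonal frame at \<open>\<gamma> t\<close>, moving by \<open>d\<close>
    scales the position by \<open>cos d\<close>, which cannot raise \<open>q\<close>, and adds a
    perpendicular vector of squared length \<open>E\<close> times the square of
    \<open>sin d\<close>.\<close>
  have step: "q (\<gamma> s) \<le> q (\<gamma> t) + E * (s - t)\<^sup>2" for s t
  proof -
    define d where "d = s - t"
    have s: "s = t + d" by (simp add: d_def)
    have "\<gamma> s = cos d *\<^sub>R \<gamma> t + sin d *\<^sub>R \<gamma>' t"
      by (simp add: s \<gamma>_def \<gamma>'_def cos_add sin_add algebra_simps)
    then have "q (\<gamma> s) \<le> q (cos d *\<^sub>R \<gamma> t) + g (sin d *\<^sub>R \<gamma>' t) (sin d *\<^sub>R \<gamma>' t)"
      using q_step[of "cos d *\<^sub>R \<gamma> t" "sin d *\<^sub>R \<gamma>' t"] gK gg by (simp add: K_simps g_simps)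
    also have "\<dots> \<le> (cos d)\<^sup>2 * q (\<gamma> t) + E * (sin d)\<^sup>2"
      using q_scale[of "cos d" "\<gamma> t"] gg by (simp add: g_simps power2_eq_square)
    also have "(cos d)\<^sup>2 * q (\<gamma> t) \<le> 1 * q (\<gamma> t)"
      using q_nonneg gK by (intro mult_right_mono) (auto simp: abs_square_le_1)
    also have "E * (sin d)\<^sup>2 \<le> E * d\<^sup>2"
      using E abs_sin_x_le_abs_x[of d] by (intro mult_left_mono) (auto simp: abs_le_square_iff)
    finally show ?thesis by (simp add: d_def)
  qed
  have "q e = q (\<gamma> 0)" by (simp add: \<gamma>_def)
  also have "\<dots> = q (\<gamma> t)"
    using quadratic_oscillation_imp_constant[of "\<lambda>t. q (\<gamma> t)"] step by blast
  also have "\<gamma> t = (1 / r) *\<^sub>R v"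
    unfolding \<gamma>_def t[symmetric] vab by (simp add: scaleR_add_right)
  also have "q \<dots> \<le> (1 / r)\<^sup>2 * q v" by (rule q_scale)
  also have "\<dots> \<le> 0" using qv by (simp add: mult_nonneg_nonpos)
  finally show False using qe by simp
qed

section \<open>The kernel of the 1-form on the complement: rank one and classification\<close>

definition H :: "'a set" where "H = {x \<in> K. \<theta> x = 0}"

lemma H_simps: "x \<in> H \<Longrightarrow> y \<in> H \<Longrightarrow> x + y \<in> H" "x \<in> H \<Longrightarrow> y \<in> H \<Longrightarrow> x - y \<in> H"
  "x \<in> H \<Longrightarrow> c *\<^sub>R x \<in> H" "x \<in> H \<Longrightarrow> - x \<in> H" "0 \<in> H" "x \<in> H \<Longrightarrow> x \<in> K" "x \<in> H \<Longrightarrow> \<theta> x = 0"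
  "x \<in> K \<Longrightarrow> y \<in> K \<Longrightarrow> br x y \<in> H"
  by (auto simp: H_def K_simps theta_simps theta_br br_K)

lemma subspace_H: "subspace H" and H_subset: "H \<subseteq> K"
  by (auto simp: subspace_def H_simps)

text \<open>The maps \<open>A x\<close> and \<open>A y\<close> are commuting skew maps and
  \<open>A x\<close> is injective on \<open>K\<close>, so \<open>Q\<close> is an inner product. An
  eigenvector \<open>v\<close> of the symmetric form of the pair relative to \<open>Q\<close> is
  killed by \<open>A x (A z v)\<close> for some \<open>z = y - (c / 2) x\<close>; applying
  \<open>m_faithful\<close> twice gives \<open>z = 0\<close>. The factor 1/2 arises because the
  symmetrised form counts the product twice.\<close>

lemma commuting_imp_proportional:
  assumes x: "x \<in> H" "x \<noteq> 0" and y: "y \<in> H" and xy: "br x y = 0"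
  obtains c where "y = c *\<^sub>R x"
proof -
  have mA: "m z v = A z v" if "z \<in> H" for z v using that by (simp add: m_def H_simps)
  define Q where "Q v w = g (A x v) (A x w)" for v w
  interpret Q: inner_space K Q
  proof (intro inner_space.intro)
    show "\<exists>B. finite B \<and> span B = K" by (rule K_finite)
    show "linear (Q v)" for v unfolding Q_def by (rule linearI) (auto simp: A_simps g_simps)
    show "Q v w = Q w v" for v w by (simp add: Q_def g_sym)
    show "Q v v > 0" if "v \<in> K" "v \<noteq> 0" for v
    proof -
      have "A x v \<noteq> 0" using m_faithful[OF that, of x] x mA H_simps by auto
      then show ?thesis unfolding Q_def using g_pos A_closed by auto
    qed
  qed
  have K0: "K \<noteq> {0}" using x H_simps by auto
  obtain v c where v: "v \<in> K" "Q v v = 1"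
    "\<And>w. w \<in> K \<Longrightarrow> g (A y v) (A x w) + g (A x v) (A y w) = c * Q v w"
  proof (rule Q.rayleigh[OF subspace_K order_refl K0, of "\<lambda>v w. g (A y v) (A x w) + g (A x v) (A y w)"])
    show "linear (\<lambda>w. g (A y v) (A x w) + g (A x v) (A y w))" for v
      by (rule linearI) (auto simp: A_simps g_simps algebra_simps)
    show "g (A y v) (A x w) + g (A x v) (A y w) = g (A y w) (A x v) + g (A x w) (A y v)" for v w
      by (simp add: g_sym)
  qed blast
  define z where "z = y - (c / 2) *\<^sub>R x"
  have zH: "z \<in> H" using x y by (simp add: z_def H_simps)
  have com: "A x (A y v) = A y (A x v)" using A_br[of x y v] xy by (simp add: A_simps)
  have "A x (A z v) = 0"
  proof (rule Kg.g_eqI)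
    fix w assume w: "w \<in> K"
    have "- g (A x (A y v)) w - g (A y (A x v)) w = - c * g (A x (A x v)) w"
      using v(3)[OF w] by (simp add: Q_def A_skew[of x _ w] A_skew[of y _ w])
    then have "g (A x (A y v)) w = c / 2 * g (A x (A x v)) w" by (simp add: com)
    then show "g (A x (A z v)) w = g 0 w" by (simp add: z_def A_simps g_simps)
  qed (use v x zH A_K K_simps H_simps in auto)
  moreover have "A z v \<in> K" using A_K zH v K_simps H_simps by auto
  ultimately have "A z v = 0" using m_faithful[of "A z v" x] x mA H_simps by auto
  moreover have "v \<noteq> 0" using v(2) by (auto simp: Q.g_simps)
  ultimately have "z = 0" using m_faithful[of v z] v zH mA H_simps by auto
  then show ?thesis using that[of "c / 2"] by (simp add: z_def)
qed

lemma br_derivation: "br x (br y z) = br (br x y) z + br y (br x z)"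
  using jacobi[of x y z] br_anti[of x z] br_anti[of "br x y" z]
  by (simp add: br_simps add_eq_0_iff2 algebra_simps)

lemma B_br_linear: "linear (\<lambda>w. B (br x v) (br x w))"
  by (rule linearI) (auto simp: br_simps KB.g_simps)

lemma B_eq_0_on:
  assumes "W \<subseteq> K" "d \<in> W" "\<And>u. u \<in> W \<Longrightarrow> B d u = 0"
  shows "d = 0"
  using KB.g_eq_0 assms by blast

text \<open>On the \<open>B\<close>-complement of \<open>x0\<close> the map ad x0 is skew, and
  injective by \<open>commuting_imp_proportional\<close>. Its slowest rotation plane supplies
  \<open>y\<close> and \<open>w\<close>. The direction of \<open>x0\<close> may be prescribed, so
  that it can later be adapted to \<open>g\<close>. The last conclusion keeps the minimality: after
  rescaling, every frequency of ad x is at least 1.\<close>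

lemma su2_subalgebra:
  assumes x0: "x0 \<in> H" "x0 \<noteq> 0" and W: "\<exists>u\<in>H. u \<noteq> 0 \<and> B x0 u = 0"
  obtains x y w c n where "x = c *\<^sub>R x0" "c \<noteq> 0" "x \<in> H" "y \<in> H" "w \<in> H"
    "br x y = w" "br y w = x" "br w x = y" "B x x = n" "B y y = n" "B w w = n" "n > 0"
    "B x y = 0" "B x w = 0" "B y w = 0"
    "\<And>u. u \<in> H \<Longrightarrow> B x u = 0 \<Longrightarrow> B u u \<le> B (br x u) (br x u)"
proof -
  define W where "W = {u \<in> H. B x0 u = 0}"
  have Ws: "subspace W" "W \<subseteq> K" "W \<noteq> {0}"
    using W by (auto simp: W_def subspace_def H_simps KB.g_simps)
  obtain y0 l where y0: "y0 \<in> W" "B y0 y0 = 1" "B (br x0 y0) (br x0 y0) = l"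
    "\<And>u. u \<in> W \<Longrightarrow> B (br x0 y0) (br x0 u) = l * B y0 u"
    "\<And>u. u \<in> W \<Longrightarrow> l * B u u \<le> B (br x0 u) (br x0 u)"
    by (rule KB.rayleigh[OF Ws, of "\<lambda>v u. B (br x0 v) (br x0 u)"]) (use B_br_linear B_sym in auto)
  have N: "B x0 x0 > 0" using B_pos x0 H_simps by auto
  have y0H: "y0 \<in> H" "B x0 y0 = 0" using y0 by (auto simp: W_def)
  have "br x0 y0 \<noteq> 0"
  proof
    assume "br x0 y0 = 0"
    then obtain c where "y0 = c *\<^sub>R x0" using commuting_imp_proportional x0 y0H by blast
    then show False using y0H y0(2) N by (auto simp: KB.g_simps)
  qed
  then have l: "l > 0" using y0(3) B_pos x0 y0H H_simps by metis
  \<comment> \<open>Scaling \<open>x0\<close> by \<open>c\<close> turns the least eigenvalue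
    \<open>l\<close> of minus the square of ad x0 into 1.\<close>
  define c where "c = 1 / sqrt l"
  have c: "c > 0" "c * c * l = 1" using l by (auto simp: c_def)
  define x where "x = c *\<^sub>R x0"
  define n where "n = B x x"
  have xH: "x \<in> H" using x0 by (simp add: x_def H_simps)
  have n: "n > 0" using N c by (simp add: n_def x_def KB.g_simps)
  define y where "y = sqrt n *\<^sub>R y0"
  define w where "w = br x y"
  have yH: "y \<in> H" and xy: "B x y = 0" and yn: "B y y = n"
    using y0H n y0(2) by (auto simp: x_def y_def H_simps KB.g_simps)
  have wH: "w \<in> H" using xH yH by (simp add: w_def H_simps)
  have W_iff: "u \<in> W \<longleftrightarrow> u \<in> H \<and> B x u = 0" for u
    using c by (auto simp: W_def x_def KB.g_simps)
  have ad_W: "br x u \<in> W" if "u \<in> K" for u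
    using that xH B_invariant[of x x u] by (simp add: W_iff H_simps br_self KB.g_simps)
  have xw: "B x w = 0" using ad_W yH W_iff by (auto simp: w_def H_simps)
  have yw: "B y w = 0" using B_invariant[of x y y] B_sym[of y w] by (simp add: w_def)
  have min: "B u u \<le> B (br x u) (br x u)" if "u \<in> W" for u
  proof -
    have "c * c * (l * B u u) \<le> c * c * B (br x0 u) (br x0 u)"
      using y0(5)[OF that] c by (intro mult_left_mono) auto
    also have "c * c * (l * B u u) = B u u" using c by (metis mult.assoc mult_1)
    finally show ?thesis by (simp add: x_def br_simps KB.g_simps)
  qed
  have xw_br: "br x w = - y"
  proof -
    have "br x w + y = 0"
    proof (rule B_eq_0_on[OF Ws(2)])
      show "br x w + y \<in> W"
        using ad_W wH yH xy W_iff by (simp add: H_simps KB.g_simps)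
      fix u assume u: "u \<in> W"
      have "B (br x w) u = - (c * c * (sqrt n * B (br x0 y0) (br x0 u)))"
        by (simp add: B_invariant w_def x_def y_def br_simps KB.g_simps)
      also have "\<dots> = - (c * c * l * (sqrt n * B y0 u))" using y0(4)[OF u] by simp
      also have "\<dots> = - B y u" using c by (simp add: y_def KB.g_simps)
      finally show "B (br x w + y) u = 0" by (simp add: KB.g_simps)
    qed
    then show ?thesis by (simp add: eq_neg_iff_add_eq_0)
  qed
  have wn: "B w w = n"
    using B_invariant[of x y w] yn by (simp add: xw_br KB.g_simps flip: w_def)
  have wx: "br w x = y" using br_anti[of w x] xw_br by simp
  \<comment> \<open>By the derivation rule the bracket of \<open>y\<close> and \<open>w\<close>
    commutes with \<open>x\<close>, hence is a multiple of \<open>x\<close>. The factor is 1 because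
    \<open>w\<close> was given the same \<open>B\<close>-length as \<open>x\<close>, through the
    choice of \<open>y\<close>.\<close>
  have yw_br: "br y w = x"
  proof -
    have "br x (br y w) = 0" by (simp add: br_derivation xw_br br_simps br_self flip: w_def)
    moreover have "x \<noteq> 0" using n by (auto simp: n_def KB.g_simps)
    ultimately obtain a where a: "br y w = a *\<^sub>R x"
      using commuting_imp_proportional[of x "br y w"] xH yH wH H_simps by metis
    have "a * n = B (br y w) x" by (simp add: a n_def KB.g_simps)
    also have "\<dots> = - B w (br y x)" by (rule B_invariant)
    also have "br y x = - w" using br_anti[of y x] by (simp add: w_def)
    also have "- B w (- w) = n" by (simp add: wn KB.g_simps)
    finally show ?thesis using a n by simp
  qed
  show ?thesis
    by (rule that[OF x_def _ xH yH wH w_def[symmetric] yw_br wx n_def[symmetric] yn wn n xy xw yw])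
       (use c min W_iff in auto)
qed

text \<open>A root string argument in real form: were there something orthogonal to the subalgebra, take its least
  root \<open>\<mu> \<ge> 1\<close> with respect to \<open>x\<close>; the pair \<open>a\<close>, \<open>b\<close> is the lowered root vector, with root \<open>\<mu> - 1\<close>.\<close>

lemma su2_subalgebra_is_all:
  assumes H: "x \<in> H" "y \<in> H" "w \<in> H"
    and br: "br x y = w" "br y w = x" "br w x = y" and n: "B x x = n" "B y y = n" "B w w = n" "n > 0"
    and ortho: "B x y = 0" "B x w = 0" "B y w = 0"
    and min: "\<And>u. u \<in> H \<Longrightarrow> B x u = 0 \<Longrightarrow> B u u \<le> B (br x u) (br x u)"
    and v: "v \<in> H"
  shows "v = (B v x / n) *\<^sub>R x + (B v y / n) *\<^sub>R y + (B v w / n) *\<^sub>R w"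
proof -
  define S where "S = {u \<in> H. B x u = 0 \<and> B y u = 0 \<and> B w u = 0}"
  have S: "subspace S" "S \<subseteq> K" by (auto simp: S_def subspace_def H_simps KB.g_simps)
  have br': "br y x = - w" "br w y = - x" "br x w = - y"
    using br br_anti by metis+
  have ad_S: "br x u \<in> S" "br y u \<in> S" "br w u \<in> S" if "u \<in> S" for u
  proof -
    have *: "B p (br q u) = - B (br q p) u" for p q by (simp add: B_invariant)
    show "br x u \<in> S" "br y u \<in> S" "br w u \<in> S"
      using that H by (auto simp: S_def H_simps * br br' br_self KB.g_simps)
  qed
  have "S = {0}"
  proof (rule ccontr)
    assume "S \<noteq> {0}"
    with S obtain u M where u: "u \<in> S" "B u u = 1" "B (br x u) (br x u) = M"
      "\<And>v. v \<in> S \<Longrightarrow> B (br x u) (br x v) = M * B u v"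
      "\<And>v. v \<in> S \<Longrightarrow> M * B v v \<le> B (br x v) (br x v)"
      by (rule KB.rayleigh[where P="\<lambda>v u. B (br x v) (br x u)"]) (use B_br_linear B_sym in auto)
    have "M \<ge> 1" using min[of u] u by (auto simp: S_def)
    define \<mu> where "\<mu> = sqrt M"
    have mu: "\<mu> \<ge> 1" "M = \<mu> * \<mu>" using \<open>M \<ge> 1\<close> by (auto simp: \<mu>_def)
    define u' where "u' = (1 / \<mu>) *\<^sub>R br x u"
    have u': "u' \<in> S" using u ad_S S by (simp add: u'_def subspace_scale)
    have xu: "br x u = \<mu> *\<^sub>R u'" using mu by (simp add: u'_def)
    have xu': "br x u' = - \<mu> *\<^sub>R u"
    proof -
      have "br x (br x u) + M *\<^sub>R u = 0"
      proof (rule B_eq_0_on[OF S(2)])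
        show "br x (br x u) + M *\<^sub>R u \<in> S"
          using u ad_S S by (simp add: subspace_add subspace_scale)
        show "B (br x (br x u) + M *\<^sub>R u) v = 0" if "v \<in> S" for v
          using u(4)[OF that] by (simp add: KB.g_simps B_invariant)
      qed
      then have "\<mu> *\<^sub>R br x u' = \<mu> *\<^sub>R (- \<mu> *\<^sub>R u)"
        by (simp add: xu mu(2) br_simps eq_neg_iff_add_eq_0)
      then show ?thesis using mu by (metis scaleR_cancel_left not_one_le_zero)
    qed
    \<comment> \<open>In complex notation \<open>a - i b\<close> is the bracket of
      \<open>y + i w\<close> with \<open>u - i u'\<close>; these have ad x-eigenvalues -i and
      \<open>i \<mu>\<close>.\<close>
    define a where "a = br y u + br w u'"
    define b where "b = br y u' - br w u"
    have ab: "a \<in> S" "b \<in> S" using u u' ad_S S by (auto simp: a_def b_def subspace_add subspace_diff)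
    have xa: "br x a = (\<mu> - 1) *\<^sub>R b"
      by (simp add: a_def b_def br_simps br_derivation[of x y] br_derivation[of x w] br br' xu xu'
          algebra_simps)
    have xb: "br x b = - (\<mu> - 1) *\<^sub>R a"
      by (simp add: a_def b_def br_simps br_derivation[of x y] br_derivation[of x w] br br' xu xu'
          algebra_simps)
    have nn: "B z z \<ge> 0" if "z \<in> S" for z using that S KB.g_nonneg by auto
    have "M * B a a \<le> (\<mu> - 1)\<^sup>2 * B b b" "M * B b b \<le> (\<mu> - 1)\<^sup>2 * B a a"
    proof -
      have "B (br x a) (br x a) = (\<mu> - 1)\<^sup>2 * B b b"
        by (simp only: xa KB.g_scale KB.g_scale' power2_eq_square mult.assoc real_scaleR_def)
      then show "M * B a a \<le> (\<mu> - 1)\<^sup>2 * B b b" using u(5)[OF ab(1)] by simp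
      have "B (br x b) (br x b) = - (\<mu> - 1) * (- (\<mu> - 1) * B a a)"
        by (simp only: xb KB.g_scale KB.g_scale' real_scaleR_def)
      then have "B (br x b) (br x b) = (\<mu> - 1)\<^sup>2 * B a a"
        by (simp add: power2_eq_square algebra_simps)
      then show "M * B b b \<le> (\<mu> - 1)\<^sup>2 * B a a" using u(5)[OF ab(2)] by simp
    qed
    \<comment> \<open>The vectors \<open>a\<close> and \<open>b\<close> would rotate with frequency
      \<open>\<mu> - 1\<close>, below the least frequency \<mu> on \<open>S\<close>. The strict gap
      uses \<open>\<mu> \<ge> 1\<close>, that is, the minimality of the frequency 1 of the
      subalgebra.\<close>
    then have "(M - (\<mu> - 1)\<^sup>2) * (B a a + B b b) \<le> 0" by (simp add: algebra_simps)
    moreover have "M - (\<mu> - 1)\<^sup>2 > 0" using mu by (simp add: power2_eq_square algebra_simps)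
    ultimately have "B a a + B b b \<le> 0" by (simp add: mult_le_0_iff)
    then have "B a a = 0" "B b b = 0" using nn ab by (smt (verit))+
    then have "a = 0" "b = 0" using KB.g_eq_0 ab S by auto
    then have eqs: "br w u' = - br y u" "br y u' = br w u"
      by (auto simp: a_def b_def add_eq_0_iff)
    \<comment> \<open>A vector killed by the lowering operator cannot have positive weight: writing
      ad x as the commutator of ad y and ad w turns \<mu> into minus a sum of two squares.\<close>
    have "\<mu> = - B u (br x u')" using u by (simp add: xu' KB.g_simps)
    also have "br x u' = br y (br w u') - br w (br y u')"
      using br_derivation[of y w u'] by (simp add: br)
    also have "- B u \<dots> = B (br y u) (br w u') - B (br w u) (br y u')"
      by (simp add: KB.g_simps B_invariant)
    also have "\<dots> = - (B (br y u) (br y u) + B (br w u) (br w u))"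
      by (simp add: eqs KB.g_simps)
    also have "\<dots> \<le> 0" using nn[OF ad_S(2)[OF u(1)]] nn[OF ad_S(3)[OF u(1)]] by simp
    finally show False using mu by simp
  qed
  moreover have "v - ((B v x / n) *\<^sub>R x + (B v y / n) *\<^sub>R y + (B v w / n) *\<^sub>R w) \<in> S"
    using H v n ortho B_sym[of y x] B_sym[of w x] B_sym[of w y] B_sym[of _ v]
    by (simp add: S_def H_simps KB.g_simps)
  ultimately show ?thesis by simp
qed

text \<open>In the third case the basis must have cross-product brackets and be
  \<open>g\<close>-orthogonal as well. So \<open>x0\<close> is taken as an eigenvector of
  \<open>g\<close> relative to \<open>B\<close>, and \<open>y\<close>, \<open>w\<close> are then
  rotated about \<open>x\<close> to reach an eigenvector of \<open>g\<close> in the plane orthogonal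
  to \<open>x\<close>; such a rotation preserves the brackets.\<close>

lemma kernel_classification:
  obtains (zero) "H = {0}"
  | (line) x where "x \<in> H" "x \<noteq> 0" "\<And>v. v \<in> H \<Longrightarrow> \<exists>a. v = a *\<^sub>R x"
  | (su2) x y w where "x \<in> H" "y \<in> H" "w \<in> H" "x \<noteq> 0" "y \<noteq> 0" "w \<noteq> 0"
      "br x y = w" "br y w = x" "br w x = y" "g x y = 0" "g y w = 0" "g w x = 0"
      "\<And>v. v \<in> H \<Longrightarrow> \<exists>a b c. v = a *\<^sub>R x + b *\<^sub>R y + c *\<^sub>R w"
proof (cases "H = {0}")
  case True
  then show ?thesis using zero by blast
next
  case False
  obtain x0 c0 where x0: "x0 \<in> H" "B x0 x0 = 1" "\<And>w. w \<in> H \<Longrightarrow> g x0 w = c0 * B x0 w"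
    by (rule KB.rayleigh[OF subspace_H H_subset False g_linear g_sym]) blast
  then have x00: "x0 \<noteq> 0" by (auto simp: KB.g_simps)
  show ?thesis
  proof (cases "\<exists>u\<in>H. u \<noteq> 0 \<and> B x0 u = 0")
    case False
    have "v = B x0 v *\<^sub>R x0" if "v \<in> H" for v
    proof -
      have "v - B x0 v *\<^sub>R x0 \<in> H" "B x0 (v - B x0 v *\<^sub>R x0) = 0"
        using that x0 by (auto simp: H_simps KB.g_simps)
      then show ?thesis using False by auto
    qed
    then show ?thesis using line x0 x00 by blast
  next
    case True
    obtain x y w c n where t: "x = c *\<^sub>R x0" "c \<noteq> 0" "x \<in> H" "y \<in> H" "w \<in> H"
      "br x y = w" "br y w = x" "br w x = y" "B x x = n" "B y y = n" "B w w = n" "n > 0"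
      "B x y = 0" "B x w = 0" "B y w = 0"
      "\<And>u. u \<in> H \<Longrightarrow> B x u = 0 \<Longrightarrow> B u u \<le> B (br x u) (br x u)"
      by (rule su2_subalgebra[OF x0(1) x00 True]) (rule that; assumption)
    have expand: "v = (B v x / n) *\<^sub>R x + (B v y / n) *\<^sub>R y + (B v w / n) *\<^sub>R w"
      if "v \<in> H" for v
      by (rule su2_subalgebra_is_all[OF t(3-15) _ that]) (rule t(16))
    define W where "W = {u \<in> H. B x u = 0}"
    have y0: "y \<noteq> 0" using t by (auto simp: KB.g_simps)
    have W: "subspace W" "W \<subseteq> K" "W \<noteq> {0}"
      using t y0 by (auto simp: W_def subspace_def H_simps KB.g_simps)
    obtain y1 c1 where y1: "y1 \<in> W" "B y1 y1 = 1" "\<And>u. u \<in> W \<Longrightarrow> g y1 u = c1 * B y1 u"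
      by (rule KB.rayleigh[OF W g_linear g_sym]) blast
    \<comment> \<open>The cosine and sine of the rotation angle: \<open>y\<close> and
      \<open>w\<close> are \<open>B\<close>-orthogonal of squared length \<open>n\<close>, and
      \<open>y'\<close> is the eigenvector \<open>y1\<close> rescaled to that length.\<close>
    define \<alpha> where "\<alpha> = B y1 y / sqrt n"
    define \<beta> where "\<beta> = B y1 w / sqrt n"
    define y' where "y' = sqrt n *\<^sub>R y1"
    define w' where "w' = br x y'"
    have "y1 = (B y1 y / n) *\<^sub>R y + (B y1 w / n) *\<^sub>R w"
      using expand[of y1] y1 B_sym[of y1 x] by (simp add: W_def)
    then have "sqrt n *\<^sub>R y1 = sqrt n *\<^sub>R ((B y1 y / n) *\<^sub>R y + (B y1 w / n) *\<^sub>R w)" by simp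
    also have "\<dots> = \<alpha> *\<^sub>R y + \<beta> *\<^sub>R w"
    proof -
      have "sqrt n * k / n = k / sqrt n" for k
        using t(12) by (simp add: field_simps flip: power2_eq_square)
      then show ?thesis by (simp add: \<alpha>_def \<beta>_def scaleR_add_right)
    qed
    finally have y': "y' = \<alpha> *\<^sub>R y + \<beta> *\<^sub>R w" by (simp add: y'_def)
    have "n = B y' y'" using y1 t(12) by (simp add: y'_def KB.g_simps)
    also have "\<dots> = (\<alpha>\<^sup>2 + \<beta>\<^sup>2) * n"
      using t B_sym[of w y] by (simp add: y' KB.g_simps power2_eq_square algebra_simps)
    finally have ab: "\<alpha>\<^sup>2 + \<beta>\<^sup>2 = 1" using t(12) by simp
    have xw: "br x w = - y" and wy: "br w y = - x" using t br_anti by metis+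
    have w': "w' = \<alpha> *\<^sub>R w - \<beta> *\<^sub>R y" by (simp add: w'_def y' br_simps t(6) xw)
    have H': "y' \<in> H" "w' \<in> H" using t by (auto simp: y' w' H_simps)
    have yw': "br y' w' = x"
    proof -
      have "br y' w' = (\<alpha>\<^sup>2 + \<beta>\<^sup>2) *\<^sub>R x"
        by (simp add: y' w' br_simps t wy br_self power2_eq_square algebra_simps)
      then show ?thesis by (simp add: ab)
    qed
    have wx': "br w' x = y'"
      using br_anti[of y x] by (simp add: y' w' br_simps t(6,8))
    have y_eq: "y = \<alpha> *\<^sub>R y' - \<beta> *\<^sub>R w'"
    proof -
      have "\<alpha> *\<^sub>R y' - \<beta> *\<^sub>R w' = (\<alpha>\<^sup>2 + \<beta>\<^sup>2) *\<^sub>R y"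
        by (simp add: y' w' power2_eq_square algebra_simps)
      then show ?thesis by (simp add: ab)
    qed
    have w_eq: "w = \<beta> *\<^sub>R y' + \<alpha> *\<^sub>R w'"
    proof -
      have "\<beta> *\<^sub>R y' + \<alpha> *\<^sub>R w' = (\<alpha>\<^sup>2 + \<beta>\<^sup>2) *\<^sub>R w"
        by (simp add: y' w' power2_eq_square algebra_simps)
      then show ?thesis by (simp add: ab)
    qed
    have x1: "g x u = 0" if "u \<in> H" "B x u = 0" for u
      using x0(3)[OF that(1)] that t(1,2) by (auto simp: g_simps KB.g_simps)
    have Bx: "B x y' = 0" "B x w' = 0" using t by (auto simp: y' w' KB.g_simps)
    have g1: "g x y' = 0" "g w' x = 0" using x1 H' Bx g_sym[of x w'] by auto
    have g2: "g y' w' = 0"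
    proof -
      have "g y1 w' = c1 * B y1 w'" using y1(3) H' Bx by (simp add: W_def)
      then have "g y' w' = c1 * B y' w'" by (simp add: y'_def g_simps KB.g_simps)
      also have "B y' w' = 0"
        using t B_sym[of w y] by (simp add: y' w' KB.g_simps algebra_simps)
      finally show ?thesis by simp
    qed
    have sp: "\<exists>a b c. v = a *\<^sub>R x + b *\<^sub>R y' + c *\<^sub>R w'" if v: "v \<in> H" for v
    proof -
      obtain a b c where "v = a *\<^sub>R x + b *\<^sub>R y + c *\<^sub>R w" using expand[OF v] by blast
      also have "\<dots> = a *\<^sub>R x + (b * \<alpha> + c * \<beta>) *\<^sub>R y' + (c * \<alpha> - b * \<beta>) *\<^sub>R w'"
        by (subst y_eq, subst w_eq) (simp add: algebra_simps)
      finally show ?thesis by blast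
    qed
    have x00': "x \<noteq> 0" using t by (auto simp: KB.g_simps)
    have yw0: "y' \<noteq> 0" "w' \<noteq> 0"
      using yw' x00' by (auto simp: br_simps)
    show ?thesis
      by (rule su2[OF t(3) H' x00' yw0 w'_def[symmetric] yw' wx' g1(1) g2 g1(2) sp])
  qed
qed

section \<open>The metric on the kernel\<close>

lemma theta_unit: "(\<And>x. x \<in> K \<Longrightarrow> m x e = x) \<Longrightarrow> x \<in> K \<Longrightarrow> g x e = \<theta> x * g e e"
  using g_m_self[of x e] by simp

lemma koszul:
  assumes "\<theta> x = 0" "\<theta> y = 0" "\<theta> z = 0"
  shows "2 * g (A x y) z = g (br x y) z - g (br x z) y - g (br y z) x"
proof -
  have "br u v = A u v - A v u" if "\<theta> u = 0" "\<theta> v = 0" for u v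
    using that by (simp add: br_def m_def)
  then show ?thesis
    using assms A_skew[of x z y] A_skew[of y z x] A_skew[of z y x] g_sym[of y] g_sym[of x] g_sym[of z]
    by (simp add: g_simps)
qed

text \<open>With \<open>e\<close> as base point, \<open>A\<close> is the Levi-Civita connection of \<open>g\<close> on \<open>H\<close> plus the second fundamental
  form of the sphere through \<open>e\<close>; the equation is the sectional curvature of the plane of \<open>x\<close>, \<open>y\<close>.\<close>

lemma curvature_equation:
  assumes e: "e \<in> K" "\<And>x. x \<in> K \<Longrightarrow> m x e = x"
    and H: "x \<in> H" "y \<in> H" "w \<in> H" "x \<noteq> 0" "y \<noteq> 0" "w \<noteq> 0"
    and br: "br x y = w" "br y w = x" "br w x = y"
    and ortho: "g x y = 0" "g y w = 0" "g w x = 0"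
    and span: "\<And>v. v \<in> H \<Longrightarrow> \<exists>a b c. v = a *\<^sub>R x + b *\<^sub>R y + c *\<^sub>R w"
  defines "p \<equiv> g x x" and "q \<equiv> g y y" and "r \<equiv> g w w" and "E \<equiv> g e e"
  shows "(2 * r * (p + q) - 3 * r\<^sup>2 + (p - q)\<^sup>2) * E = 4 * p * q * r"
proof -
  have pos: "p > 0" "q > 0" "r > 0"
    using H by (auto simp: p_def q_def r_def H_simps intro!: Kg.g_pos)
  have th: "\<theta> x = 0" "\<theta> y = 0" "\<theta> w = 0" using H H_simps by auto
  have KK: "x \<in> K" "y \<in> K" "w \<in> K" using H H_simps by auto
  have Ae: "A u e = u" if "u \<in> H" for u using e(2)[of u] that by (simp add: m_def H_simps)
  have "e \<noteq> 0" using Ae[OF H(1)] H(4) by (auto simp: A_simps)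
  then have E: "E > 0" using Kg.g_pos[OF e(1)] by (simp add: E_def)
  have br': "br y x = - w" "br w y = - x" "br x w = - y"
    using br br_anti by metis+
  have ortho': "g y x = 0" "g w y = 0" "g x w = 0" using ortho g_sym by auto
  have ge: "g u e = 0" if "u \<in> H" for u using theta_unit[OF e(2)] that H_simps by auto
  have ge': "g e u = 0" if "u \<in> H" for u using ge[OF that] g_sym by simp
  have te: "\<theta> e = 1"
    using theta_unit[OF e(2) e(1)] E by (simp add: E_def)
  \<comment> \<open>Up to the factor \<open>E\<close>, \<open>e\<close> is the metric dual of
    \<theta> on \<open>K\<close>, so \<open>K\<close> is the orthogonal sum of the line of
    \<open>e\<close> and \<open>H\<close>, and four inner products determine a vector.\<close>
  have zero: "v = 0" if v: "v \<in> K" "g v e = 0" "g v x = 0" "g v y = 0" "g v w = 0" for v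
  proof -
    have "v \<in> H" using theta_unit[OF e(2) v(1)] v E by (simp add: H_def E_def)
    then obtain a b c where vv: "v = a *\<^sub>R x + b *\<^sub>R y + c *\<^sub>R w" using span by blast
    have "g v (a *\<^sub>R x + b *\<^sub>R y + c *\<^sub>R w) = 0" using v by (simp add: g_simps)
    then have "g v v = 0" by (simp only: vv[symmetric])
    then show ?thesis using v Kg.g_eq_0 by simp
  qed
  \<comment> \<open>The coefficient that the Koszul formula prescribes for \<open>A x y\<close>
    along \<open>w\<close>.\<close>
  define \<alpha> where "\<alpha> = (r + q - p) / (2 * r)"
  have Axy: "A x y = \<alpha> *\<^sub>R w"
  proof -
    have "A x y - \<alpha> *\<^sub>R w = 0"
    proof (rule zero)
      show "A x y - \<alpha> *\<^sub>R w \<in> K" using KK A_K by (simp add: K_simps)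
      show "g (A x y - \<alpha> *\<^sub>R w) e = 0"
        using A_skew[of x y e] Ae H ge ortho' by (simp add: g_simps)
      show "g (A x y - \<alpha> *\<^sub>R w) x = 0"
        using koszul[of x y x] th by (simp add: g_simps br br' br_self ortho ortho')
      show "g (A x y - \<alpha> *\<^sub>R w) y = 0" by (simp add: g_simps g_A_self ortho')
      show "g (A x y - \<alpha> *\<^sub>R w) w = 0"
      proof -
        have "2 * g (A x y) w = r + q - p"
          using koszul[of x y w] th by (simp add: g_simps br br' p_def q_def r_def)
        moreover have "\<alpha> * r = (r + q - p) / 2" using pos by (simp add: \<alpha>_def)
        ultimately show ?thesis by (simp add: g_simps flip: r_def)
      qed
    qed
    then show ?thesis by simp
  qed
  have Ayx: "A y x = (\<alpha> - 1) *\<^sub>R w"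
    using br(1) Axy th by (simp add: br_def m_def algebra_simps)
  \<comment> \<open>The second fundamental form: skewness and \<open>A x e = x\<close> give
    \<open>g (A x x) e = - p\<close>, and the tangential components vanish by Koszul and
    orthogonality.\<close>
  have Axx: "A x x = - (p / E) *\<^sub>R e"
  proof -
    have "A x x + (p / E) *\<^sub>R e = 0"
    proof (rule zero)
      show "A x x + (p / E) *\<^sub>R e \<in> K" using KK A_K e by (simp add: K_simps)
      show "g (A x x + (p / E) *\<^sub>R e) e = 0"
        using A_skew[of x x e] Ae H E by (simp add: g_simps p_def E_def)
      show "g (A x x + (p / E) *\<^sub>R e) x = 0" using H by (simp add: g_simps g_A_self ge')
      show "g (A x x + (p / E) *\<^sub>R e) y = 0"
        using koszul[of x x y] th H by (simp add: g_simps br br' br_self ortho ortho' ge')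
      show "g (A x x + (p / E) *\<^sub>R e) w = 0"
        using koszul[of x x w] th H by (simp add: g_simps br br' br_self ortho ortho' ge')
    qed
    then show ?thesis by (simp add: eq_neg_iff_add_eq_0)
  qed
  \<comment> \<open>The same number is computed twice, by the Koszul formula and by flatness, since
    \<open>w\<close> is the bracket of \<open>x\<close> and \<open>y\<close>.\<close>
  have "2 * g (A w x) y = q + p - r"
    using koszul[of w x y] th by (simp add: br br' g_simps p_def q_def r_def)
  moreover have "A w x = A x (A y x) - A y (A x x)" using A_br[of x y x] by (simp add: br)
  moreover have "g (A x (A y x)) y = - (\<alpha> * (\<alpha> - 1) * r)"
    using A_skew[of x "A y x" y] by (simp add: Axy Ayx g_simps r_def)
  moreover have "g (A y (A x x)) y = - (p / E * q)"
    using Ae[OF H(2)] by (simp add: Axx A_simps g_simps q_def)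
  ultimately have "q + p - r = 2 * (p / E * q - \<alpha> * (\<alpha> - 1) * r)"
    by (simp add: g_simps)
  also have "\<alpha> * (\<alpha> - 1) * r = (r + q - p) * (q - p - r) / (4 * r)"
    using pos by (simp add: \<alpha>_def field_simps)
  finally have "(q + p - r) * (2 * r * E) = (2 * (p / E * q - (r + q - p) * (q - p - r) / (4 * r))) * (2 * r * E)"
    by simp
  also have "\<dots> = 4 * p * q * r - (r + q - p) * (q - p - r) * E"
    using pos E by (simp add: field_simps)
  finally show ?thesis by (simp add: power2_eq_square algebra_simps)
qed

text \<open>The three cyclic curvature equations share their right-hand side. Their differences
  factor, and positivity leaves only \<open>p = q = r\<close>; the equation then reads
  \<open>p\<^sup>2 * E = 4 * p ^ 3\<close>.\<close>

lemma round_metric: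
  assumes e: "e \<in> K" "\<And>x. x \<in> K \<Longrightarrow> m x e = x"
    and H: "x \<in> H" "y \<in> H" "w \<in> H" "x \<noteq> 0" "y \<noteq> 0" "w \<noteq> 0"
    and br: "br x y = w" "br y w = x" "br w x = y"
    and ortho: "g x y = 0" "g y w = 0" "g w x = 0"
    and span: "\<And>v. v \<in> H \<Longrightarrow> \<exists>a b c. v = a *\<^sub>R x + b *\<^sub>R y + c *\<^sub>R w"
  shows "g x x = g e e / 4" "g y y = g e e / 4" "g w w = g e e / 4"
proof -
  define p q r E where "p = g x x" and "q = g y y" and "r = g w w" and "E = g e e"
  have pos: "p > 0" "q > 0" "r > 0"
    using H by (auto simp: p_def q_def r_def H_simps intro!: Kg.g_pos)
  have "m x e = x" using e(2) H H_simps by auto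
  then have "e \<noteq> 0" using H(4) by (auto simp: m_simps)
  then have E: "E > 0" using Kg.g_pos[OF e(1)] by (simp add: E_def)
  have span2: "\<exists>a b c. v = a *\<^sub>R y + b *\<^sub>R w + c *\<^sub>R x" if "v \<in> H" for v
    using span[OF that] by (metis add.commute add.left_commute)
  have span3: "\<exists>a b c. v = a *\<^sub>R w + b *\<^sub>R x + c *\<^sub>R y" if "v \<in> H" for v
    using span[OF that] by (metis add.commute add.left_commute)
  have 1: "(2 * r * (p + q) - 3 * r\<^sup>2 + (p - q)\<^sup>2) * E = 4 * p * q * r"
    unfolding p_def q_def r_def E_def by (rule curvature_equation[OF e H br ortho span])
  have 2: "(2 * p * (q + r) - 3 * p\<^sup>2 + (q - r)\<^sup>2) * E = 4 * p * q * r"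
    using curvature_equation[OF e H(2,3,1,5,6,4) br(2,3,1) ortho(2,3,1) span2]
    by (simp add: p_def q_def r_def E_def mult_ac)
  have 3: "(2 * q * (r + p) - 3 * q\<^sup>2 + (r - p)\<^sup>2) * E = 4 * p * q * r"
    using curvature_equation[OF e H(3,1,2,6,4,5) br(3,1,2) ortho(3,1,2) span3]
    by (simp add: p_def q_def r_def E_def mult_ac)
  have "2 * r * (p + q) - 3 * r\<^sup>2 + (p - q)\<^sup>2 = 2 * p * (q + r) - 3 * p\<^sup>2 + (q - r)\<^sup>2"
    by (rule mult_right_cancel[THEN iffD1, OF _ trans[OF 1 2[symmetric]]]) (use E in simp)
  then have "4 * (p - r) * (p + r - q) = 0" by (simp add: power2_eq_square algebra_simps)
  then have a: "p = r \<or> q = p + r" by auto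
  have "2 * r * (p + q) - 3 * r\<^sup>2 + (p - q)\<^sup>2 = 2 * q * (r + p) - 3 * q\<^sup>2 + (r - p)\<^sup>2"
    by (rule mult_right_cancel[THEN iffD1, OF _ trans[OF 1 3[symmetric]]]) (use E in simp)
  then have "4 * (q - r) * (q + r - p) = 0" by (simp add: power2_eq_square algebra_simps)
  then have b: "q = r \<or> p = q + r" by auto
  have "2 * p * (q + r) - 3 * p\<^sup>2 + (q - r)\<^sup>2 = 2 * q * (r + p) - 3 * q\<^sup>2 + (r - p)\<^sup>2"
    by (rule mult_right_cancel[THEN iffD1, OF _ trans[OF 2 3[symmetric]]]) (use E in simp)
  then have "4 * (p - q) * (p + q - r) = 0" by (simp add: power2_eq_square algebra_simps)
  then have c: "p = q \<or> r = p + q" by auto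
  have pq: "q = p" "r = p" using a b c pos by auto
  then have "p = E / 4" using 1 pos E by (simp add: power2_eq_square)
  with pq show "g x x = g e e / 4" "g y y = g e e / 4" "g w w = g e e / 4"
    by (simp_all add: p_def q_def r_def E_def)
qed

end

section \<open>Frames, su(2) and coordinates\<close>

text \<open>\<open>trace_on\<close> uses a basis picked by choice, so a computation needs
  independence of the basis. Expanding in both systems and swapping the sums is the identity tr(RS)
  = tr(SR).\<close>

lemma trace_on_frame:
  fixes V :: "'a::real_vector set" and c :: "'i \<Rightarrow> 'a \<Rightarrow> real"
  assumes V: "subspace V" and f: "linear_on V f" "\<And>v. v \<in> V \<Longrightarrow> f v \<in> V"
    and I: "finite I" "\<And>i. i \<in> I \<Longrightarrow> e i \<in> V" "\<And>i. linear (c i)"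
    and frame: "\<And>v. v \<in> V \<Longrightarrow> v = (\<Sum>i\<in>I. c i v *\<^sub>R e i)"
  shows "trace_on V f = (\<Sum>i\<in>I. c i (f (e i)))"
proof -
  define B where "B = (SOME B. independent B \<and> span B = V)"
  obtain B' where "B' \<subseteq> V" "independent B'" "V \<subseteq> span B'"
    using maximal_independent_subset by blast
  then have "independent B' \<and> span B' = V"
    using V by (simp add: span_minimal subset_antisym)
  then have B: "independent B" "span B = V"
    unfolding B_def by (rule someI[of "\<lambda>B. independent B \<and> span B = V", THEN conjunct1],
        rule someI[of "\<lambda>B. independent B \<and> span B = V", THEN conjunct2])
  have BV: "b \<in> V" if "b \<in> B" for b using that B span_base by blast
  have "B \<subseteq> span (e ` I)"
  proof
    fix b assume "b \<in> B"
    then have "b = (\<Sum>i\<in>I. c i b *\<^sub>R e i)" using frame BV by blast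
    also have "\<dots> \<in> span (e ` I)" by (intro span_sum span_scale span_base) auto
    finally show "b \<in> span (e ` I)" .
  qed
  then have fin: "finite B" using independent_span_bound[OF finite_imageI[OF I(1)] B(1)] by blast
  have rep: "(\<Sum>b\<in>B. representation B v b *\<^sub>R b) = v" if "v \<in> V" for v
    using sum_representation_eq[OF B(1), of v B] that B fin by simp
  have f0: "f 0 = 0"
    using f(1) V subspace_0[OF V] unfolding linear_on_def by (metis scale_zero_left)
  have f_sum: "f (\<Sum>b\<in>S. r b *\<^sub>R b) = (\<Sum>b\<in>S. r b *\<^sub>R f b)" if "finite S" "S \<subseteq> B" for S r
    using that
  proof (induction S)
    case (insert b S)
    have "(\<Sum>b\<in>S. r b *\<^sub>R b) \<in> V"
      using insert.prems BV V by (intro subspace_sum subspace_scale) auto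
    moreover have "b \<in> V" "r b *\<^sub>R b \<in> V" using insert.prems BV V by (auto simp: subspace_scale)
    ultimately show ?case
      using insert f(1) by (simp add: linear_on_def)
  qed (simp add: f0)
  have "trace_on V f = (\<Sum>b\<in>B. representation B (f b) b)"
    by (simp add: trace_on_def B_def Let_def)
  also have "\<dots> = (\<Sum>b\<in>B. \<Sum>i\<in>I. c i (f b) * representation B (e i) b)"
  proof (rule sum.cong[OF refl])
    fix b assume "b \<in> B"
    then have "f b \<in> V" using f BV by blast
    then have "representation B (f b) b = representation B (\<Sum>i\<in>I. c i (f b) *\<^sub>R e i) b"
      using frame[of "f b"] by simp
    also have "\<dots> = (\<Sum>i\<in>I. c i (f b) * representation B (e i) b)"
      using B I V by (simp add: representation_sum representation_scale subspace_scale)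
    finally show "representation B (f b) b = (\<Sum>i\<in>I. c i (f b) * representation B (e i) b)" .
  qed
  also have "\<dots> = (\<Sum>i\<in>I. \<Sum>b\<in>B. representation B (e i) b * c i (f b))"
    by (subst sum.swap) (simp add: mult.commute)
  also have "\<dots> = (\<Sum>i\<in>I. c i (f (e i)))"
  proof (rule sum.cong[OF refl])
    fix i assume "i \<in> I"
    then have "e i = (\<Sum>b\<in>B. representation B (e i) b *\<^sub>R b)" using rep I by simp
    then have "f (e i) = f (\<Sum>b\<in>B. representation B (e i) b *\<^sub>R b)" by simp
    also have "\<dots> = (\<Sum>b\<in>B. representation B (e i) b *\<^sub>R f b)" using f_sum fin by blast
    finally show "(\<Sum>b\<in>B. representation B (e i) b * c i (f b)) = c i (f (e i))"
      by (simp add: linear_sum[OF I(3)] linear_scale[OF I(3)])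
  qed
  finally show ?thesis .
qed

text \<open>Coordinates with respect to the basis \<open>- (\<i>/2) \<sigma>\<^sub>k\<close>, in which the commutator is the cross product.\<close>

definition su2_mat :: "real \<Rightarrow> real \<Rightarrow> real \<Rightarrow> complex^2^2" where
  "su2_mat a b c = vector [vector [Complex 0 (- c / 2), Complex (- b / 2) (- a / 2)],
                           vector [Complex (b / 2) (- a / 2), Complex 0 (c / 2)]]"

definition su2_coord :: "nat \<Rightarrow> complex^2^2 \<Rightarrow> real" where
  "su2_coord i M = (if i = 0 then - 2 * Im (M $ 1 $ 2) else if i = 1 then - 2 * Re (M $ 1 $ 2)
     else - 2 * Im (M $ 1 $ 1))"

lemma su2_coord_mat:
  "su2_coord 0 (su2_mat a b c) = a" "su2_coord (Suc 0) (su2_mat a b c) = b" "su2_coord 2 (su2_mat a b c) = c"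
  by (auto simp: su2_coord_def su2_mat_def)

lemma linear_su2_coord: "linear (su2_coord i)"
  by (rule linearI) (auto simp: su2_coord_def)

lemma su2_mat_in: "su2_mat a b c \<in> su2"
  by (simp add: su2_def su2_mat_def conj_transpose_def trace_def sum_2 vec_eq_iff forall_2 complex_eq_iff)

lemma su2_mat_coord:
  assumes "M \<in> su2"
  shows "M = su2_mat (su2_coord 0 M) (su2_coord 1 M) (su2_coord 2 M)"
proof -
  have h: "cnj (M $ j $ i) = - M $ i $ j" for i j
    using assms by (simp add: su2_def conj_transpose_def vec_eq_iff)
  have "M $ 1 $ 1 + M $ 2 $ 2 = 0" using assms by (simp add: su2_def trace_def sum_2)
  then show ?thesis
    using h[of 1 1] h[of 1 2] h[of 2 2]
    by (auto simp: su2_mat_def su2_coord_def vec_eq_iff forall_2 complex_eq_iff)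
qed

lemma su2E:
  assumes "M \<in> su2"
  obtains a b c where "M = su2_mat a b c"
  using su2_mat_coord assms by blast

lemma su2_mat_linear:
  "su2_mat a b c + su2_mat a' b' c' = su2_mat (a + a') (b + b') (c + c')"
  "r *\<^sub>R su2_mat a b c = su2_mat (r * a) (r * b) (r * c)"
  by (simp_all add: su2_mat_def vec_eq_iff forall_2 complex_eq_iff add_divide_distrib)

lemma su2_mat_0: "su2_mat 0 0 0 = 0"
  by (simp add: su2_mat_def vec_eq_iff forall_2 complex_eq_iff)

lemma subspace_su2: "subspace su2"
  unfolding subspace_def
proof (intro conjI ballI allI)
  show "0 \<in> su2" using su2_mat_in[of 0 0 0] by (simp add: su2_mat_0)
qed (auto elim!: su2E simp: su2_mat_linear su2_mat_in)

lemma commutator_su2_mat: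
  "commutator (su2_mat a b c) (su2_mat a' b' c') =
     su2_mat (b * c' - c * b') (c * a' - a * c') (a * b' - b * a')"
  by (simp add: commutator_def su2_mat_def matrix_matrix_mult_def sum_2 vec_eq_iff forall_2
      complex_eq_iff field_simps)

text \<open>The map sends v to a x (a' x v) = (a.v) a' - (a.a') v, whose trace on a
  three-dimensional space is (1 - 3) a.a'.\<close>

lemma killing_form_su2:
  "killing_form su2 commutator (su2_mat a b c) (su2_mat a' b' c') = - 2 * (a * a' + b * b' + c * c')"
proof -
  define e :: "nat \<Rightarrow> complex^2^2" where
    "e i = su2_mat (if i = 0 then 1 else 0) (if i = 1 then 1 else 0) (if i = 2 then 1 else 0)" for i
  define f where "f v = commutator (su2_mat a b c) (commutator (su2_mat a' b' c') v)" for v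
  have lin: "linear_on su2 f"
    unfolding linear_on_def
    by (auto elim!: su2E simp: su2_mat_linear f_def commutator_su2_mat algebra_simps)
  have "trace_on su2 f = (\<Sum>i\<in>{0,1,2}. su2_coord i (f (e i)))"
  proof (intro trace_on_frame subspace_su2 linear_su2_coord lin)
    show "v = (\<Sum>i\<in>{0,1,2}. su2_coord i v *\<^sub>R e i)" if "v \<in> su2" for v
      using su2_mat_coord[OF that] by (simp add: e_def su2_mat_linear)
  qed (auto elim!: su2E simp: f_def e_def commutator_su2_mat su2_mat_in)
  also have "\<dots> = - 2 * (a * a' + b * b' + c * c')"
    by (simp add: f_def e_def commutator_su2_mat su2_coord_mat)
  finally show ?thesis by (simp add: killing_form_def f_def[abs_def])
qed

lemma lie_center_su2_R: "lie_center su2_R su2_R_bracket = span {(0, 1)}"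
proof -
  have "x \<in> lie_center su2_R su2_R_bracket \<longleftrightarrow> (\<exists>k. x = k *\<^sub>R (0, 1))" for x
  proof
    assume x: "x \<in> lie_center su2_R su2_R_bracket"
    then obtain a b c t where abc: "x = (su2_mat a b c, t)"
      by (cases x) (auto simp: lie_center_def su2_R_def elim!: su2E)
    have com: "commutator (su2_mat a b c) (su2_mat a' b' c') = 0" for a' b' c'
      using x su2_mat_in unfolding abc lie_center_def su2_R_def su2_R_bracket_def
      by (auto simp: zero_prod_def)
    have "su2_coord 1 (commutator (su2_mat a b c) (su2_mat 1 0 0)) = 0"
      "su2_coord 2 (commutator (su2_mat a b c) (su2_mat 1 0 0)) = 0"
      "su2_coord 2 (commutator (su2_mat a b c) (su2_mat 0 1 0)) = 0"
      unfolding com by (simp_all add: su2_coord_def)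
    then have "a = 0" "b = 0" "c = 0" by (simp_all add: commutator_su2_mat su2_coord_mat)
    then show "\<exists>k. x = k *\<^sub>R (0, 1)" by (auto simp: abc su2_mat_0)
  next
    assume "\<exists>k. x = k *\<^sub>R (0, 1)"
    then show "x \<in> lie_center su2_R su2_R_bracket"
      using subspace_0[OF subspace_su2]
      by (auto simp: lie_center_def su2_R_def su2_R_bracket_def commutator_def zero_prod_def)
  qed
  then show ?thesis by (auto simp: span_singleton)
qed

section \<open>Coordinates in Euclidean space and pulled-back inner products\<close>

lemma lookup_scaleR: "Poly_Mapping.lookup (c *\<^sub>R v) i = c *\<^sub>R Poly_Mapping.lookup v i"
proof -
  have "finite {i. c *\<^sub>R Poly_Mapping.lookup v i \<noteq> 0}"
    by (rule finite_subset[OF _ finite_lookup[of v]]) auto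
  then show ?thesis by (simp add: scaleR_poly_mapping_def)
qed

definition evec :: "nat \<Rightarrow> (nat \<Rightarrow> real) \<Rightarrow> nat \<Rightarrow>\<^sub>0 real" where
  "evec n f = (\<Sum>i<n. Poly_Mapping.single i (f i))"

lemma lookup_evec: "Poly_Mapping.lookup (evec n f) i = (if i < n then f i else 0)"
  by (simp add: evec_def lookup_sum lookup_single when_def)

lemma evec_in: "evec n f \<in> euclid n"
  by (auto simp: euclid_def in_keys_iff lookup_evec split: if_splits)

lemma evec_lookup: "v \<in> euclid n \<Longrightarrow> evec n (Poly_Mapping.lookup v) = v"
  by (rule poly_mapping_eqI) (auto simp: lookup_evec euclid_def in_keys_iff subset_iff)

lemma evec_simps: "evec n (\<lambda>i. f i + h i) = evec n f + evec n h"
  "evec n (\<lambda>i. c * f i) = c *\<^sub>R evec n f"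
  "evec n (\<lambda>i. f i - h i) = evec n f - evec n h" "evec n (\<lambda>i. 0) = 0"
  by (auto intro!: poly_mapping_eqI simp: lookup_evec lookup_add lookup_scaleR lookup_minus)

lemma subspace_euclid: "subspace (euclid n)"
  unfolding subspace_def
  by (auto simp: euclid_def subset_iff in_keys_iff lookup_add lookup_scaleR) (metis add_0)

lemma inner_product_on_pullback:
  assumes K: "subspace K" and j: "linear_on K j" "inj_on j K" "j ` K \<subseteq> V" and "inner_space V g"
  shows "inner_product_on K (\<lambda>a b. g (j a) (j b))"
proof -
  interpret inner_space V g by fact
  have j0: "j 0 = 0"
    using j(1) subspace_0[OF K] unfolding linear_on_def by (metis scale_zero_left)
  have "j x \<noteq> 0" if "x \<in> K" "x \<noteq> 0" for x
    using j(2) that j0 subspace_0[OF K] by (metis inj_onD)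
  then show ?thesis
    using j by (auto simp: inner_product_on_def bilinear_on_def linear_on_def g_simps g_sym intro!: g_pos)
qed

section \<open>The semidirect model\<close>

context flat_similarity
begin

text \<open>For \<open>k\<close>, \<open>l\<close> in \<open>K\<close> and \<open>s\<close>,
  \<open>r\<close> in \<open>T\<close> the bracket of \<open>k + s\<close> and \<open>l + r\<close>
  is \<open>br k l + (m k r - m l s)\<close>, because \<open>T\<close> acts by zero. So
  \<open>K\<close> acts on \<open>T\<close> by \<open>m\<close>, whose skew part read in an
  orthonormal basis of \<open>T\<close> is \<beta>. The algebra \<open>Kc\<close> is any copy of
  \<open>K\<close>, so one construction serves both kinds of model.\<close>

lemma semidirect_model_exists:
  fixes Kc :: "'k::real_vector set" and j :: "'k \<Rightarrow> 'a" and brkK :: "'k \<Rightarrow> 'k \<Rightarrow> 'k"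
  assumes Kc: "subspace Kc" and bij: "bij_betw j Kc K" and lin: "linear_on Kc j"
    and brkK: "\<And>a b. a \<in> Kc \<Longrightarrow> b \<in> Kc \<Longrightarrow> brkK a b \<in> Kc"
      "\<And>a b. a \<in> Kc \<Longrightarrow> b \<in> Kc \<Longrightarrow> j (brkK a b) = br (j a) (j b)"
    and agree: "\<And>x y. x \<in> L \<Longrightarrow> y \<in> L \<Longrightarrow> brk x y = br x y"
      "\<And>x y. x \<in> L \<Longrightarrow> y \<in> L \<Longrightarrow> g0 x y = g x y" "\<And>x. x \<in> L \<Longrightarrow> \<theta>0 x = \<theta> x"
  shows "\<exists>n \<beta> \<phi>. orthogonal_representation Kc brkK n \<beta> \<and>
    semidirect_model L brk g0 \<theta>0 Kc brkK (\<lambda>a b. g (j a) (j b)) (\<lambda>a. \<theta> (j a)) n \<beta> \<phi>"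
proof -
  obtain C where C: "onb C T" using onb_exists[OF subspace_T T_subset] by blast
  then obtain t :: "nat \<Rightarrow> 'a" and n where t: "C = t ` {..<n}" "inj_on t {..<n}"
    unfolding onb_def using finite_imp_nat_seg_image_inj_on[of C] by (metis lessThan_def)
  have tT: "t i \<in> T" if "i < n" for i using onb_subset[OF C] t that by auto
  have tt: "g (t i) (t k) = (if i = k then 1 else 0)" if "i < n" "k < n" for i k
    using C t that by (auto simp: onb_def inj_on_def)
  define co where "co x = evec n (\<lambda>i. g x (t i))" for x
  define vec where "vec v = (\<Sum>i<n. Poly_Mapping.lookup v i *\<^sub>R t i)" for v :: "nat \<Rightarrow>\<^sub>0 real"
  have co_lin: "co (x + y) = co x + co y" "co (x - y) = co x - co y" "co (c *\<^sub>R x) = c *\<^sub>R co x" for x y c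
    by (simp_all add: co_def g_simps evec_simps)
  have co_in: "co x \<in> euclid n" for x by (simp add: co_def evec_in)
  have vec_lin: "vec (v + w) = vec v + vec w" "vec (c *\<^sub>R v) = c *\<^sub>R vec v" for v w c
    by (simp_all add: vec_def lookup_add lookup_scaleR scaleR_add_left sum.distrib scaleR_sum_right)
  have vecT: "vec v \<in> T" for v
    unfolding vec_def using tT subspace_T by (intro subspace_sum subspace_scale) auto
  have vec_co: "vec (co x) = x" if "x \<in> T" for x
  proof -
    have "x = (\<Sum>b\<in>C. g x b *\<^sub>R b)" by (rule onb_expansion[OF C that])
    also have "\<dots> = vec (co x)" by (simp add: t sum.reindex vec_def co_def lookup_evec)
    finally show ?thesis by simp
  qed
  have co_vec: "co (vec v) = v" if "v \<in> euclid n" for v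
  proof -
    have "g (vec v) (t k) = Poly_Mapping.lookup v k" if "k < n" for k
    proof -
      have "g (vec v) (t k) = (\<Sum>i<n. Poly_Mapping.lookup v i * g (t i) (t k))"
        by (simp add: vec_def g_simps)
      also have "\<dots> = (\<Sum>i<n. if i = k then Poly_Mapping.lookup v i else 0)"
        by (intro sum.cong refl) (use tt that in auto)
      finally show ?thesis using that by simp
    qed
    then have "co (vec v) = evec n (Poly_Mapping.lookup v)"
      by (auto intro!: poly_mapping_eqI simp: co_def lookup_evec)
    then show ?thesis using evec_lookup[OF that] by simp
  qed
  have inner_co: "euclid_inner n (co x) (co y) = g x y" if "x \<in> T" for x y
  proof -
    have "g x y = (\<Sum>b\<in>C. g x b * g y b)" by (rule parseval[OF C that])
    then show ?thesis by (simp add: t sum.reindex euclid_inner_def co_def lookup_evec)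
  qed
  have co_K: "co k = 0" if "k \<in> K" for k
    using that tT by (auto intro!: poly_mapping_eqI simp: co_def lookup_evec K_def)
  define kp where "kp x = x - vec (co x)" for x
  have kpK: "kp x \<in> K" if x: "x \<in> L" for x
  proof -
    obtain k s where ks: "k \<in> K" "s \<in> T" "x = k + s" using K_T_decomposition[OF x] by blast
    then have "kp x = k" by (simp add: kp_def co_lin co_K vec_co)
    then show ?thesis using ks by simp
  qed
  have kp_eq: "kp (k + s) = k" "co (k + s) = co s" if "k \<in> K" "s \<in> T" for k s
    using that by (simp_all add: kp_def co_lin co_K vec_co)
  have split: "x = kp x + vec (co x)" for x by (simp add: kp_def)
  define ji where "ji = the_inv_into Kc j"
  have inj: "inj_on j Kc" and im: "j ` Kc = K" using bij by (auto simp: bij_betw_def)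
  have ji: "ji k \<in> Kc" "j (ji k) = k" if "k \<in> K" for k
    using that im inj by (auto simp: ji_def f_the_inv_into_f the_inv_into_into)
  have ij: "ji (j a) = a" if "a \<in> Kc" for a using that inj by (simp add: ji_def the_inv_into_f_f)
  have jK: "j a \<in> K" if "a \<in> Kc" for a using that im by auto
  have jL: "j a \<in> L" if "a \<in> Kc" for a using jK[OF that] K_simps(6) by simp
  have j_lin: "a \<in> Kc \<Longrightarrow> b \<in> Kc \<Longrightarrow> j (a + b) = j a + j b" "a \<in> Kc \<Longrightarrow> j (c *\<^sub>R a) = c *\<^sub>R j a" for a b c
    using lin by (auto simp: linear_on_def)
  have ji_add: "ji (k + l) = ji k + ji l" if "k \<in> K" "l \<in> K" for k l
    using ij[of "ji k + ji l"] ji that j_lin Kc by (simp add: subspace_add)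
  have ji_scale: "ji (c *\<^sub>R k) = c *\<^sub>R ji k" if "k \<in> K" for k c
    using ij[of "c *\<^sub>R ji k"] ji that j_lin Kc by (simp add: subspace_scale)
  have ji_br: "ji (br k l) = brkK (ji k) (ji l)" if "k \<in> K" "l \<in> K" for k l
    using ij[of "brkK (ji k) (ji l)"] ji that brkK by simp
  define \<beta> where "\<beta> a v = co (A (j a) (vec v))" for a v
  define \<phi> where "\<phi> x = (ji (kp x), co x)" for x
  have rep: "orthogonal_representation Kc brkK n \<beta>"
    unfolding orthogonal_representation_def lie_representation_def
  proof (intro conjI ballI)
    fix a assume a: "a \<in> Kc"
    show "linear_on (euclid n) (\<beta> a)"
      by (simp add: linear_on_def \<beta>_def vec_lin A_simps co_lin)
    show "\<beta> a ` euclid n \<subseteq> euclid n" by (auto simp: \<beta>_def co_in)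
    fix b v assume b: "b \<in> Kc"
    show "\<beta> (brkK a b) v = \<beta> a (\<beta> b v) - \<beta> b (\<beta> a v)"
      using a b by (simp add: \<beta>_def brkK A_br co_lin vec_co A_T jL vecT)
  next
    fix v show "linear_on Kc (\<lambda>a. \<beta> a v)"
      using lin by (simp add: linear_on_def \<beta>_def A_simps co_lin)
  next
    fix a v w assume a: "a \<in> Kc" and v: "v \<in> euclid n" and w: "w \<in> euclid n"
    have "euclid_inner n (\<beta> a v) w = euclid_inner n (co (A (j a) (vec v))) (co (vec w))"
      using w by (simp add: \<beta>_def co_vec)
    also have "\<dots> = g (A (j a) (vec v)) (vec w)" by (rule inner_co) (simp add: A_T jL a vecT)
    also have "\<dots> = - g (vec v) (A (j a) (vec w))" by (rule A_skew)
    also have "\<dots> = - euclid_inner n (co (vec v)) (co (A (j a) (vec w)))" by (simp add: inner_co vecT)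
    finally show "euclid_inner n (\<beta> a v) w = - euclid_inner n v (\<beta> a w)"
      using v by (simp add: \<beta>_def co_vec)
  qed
  have hom: "\<phi> (br x y) = semidirect_bracket brkK (\<lambda>a v. \<theta> (j a) *\<^sub>R v + \<beta> a v) (\<phi> x) (\<phi> y)"
    if x: "x \<in> L" and y: "y \<in> L" for x y
  proof -
    define k s l r where "k = kp x" and "s = vec (co x)" and "l = kp y" and "r = vec (co y)"
    have kl: "k \<in> K" "l \<in> K" "s \<in> T" "r \<in> T" using kpK x y vecT by (auto simp: k_def l_def s_def r_def)
    have KL: "k \<in> L" "l \<in> L" "s \<in> L" "r \<in> L" using kl K_subset T_subset by auto
    have ms: "m s u = 0" "m r u = 0" if "u \<in> L" for u
      using kl that by (auto simp: m_def T_def)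
    have mT: "m k r \<in> T" "m l s \<in> T"
      unfolding m_def using kl KL A_T subspace_T by (auto intro!: subspace_add subspace_scale)
    have eq: "br x y = br k l + (m k r - m l s)"
    proof -
      have "br (k + s) (l + r) = br k l + (m k r - m l s)"
        using ms KL by (simp add: br_def m_simps)
      then show ?thesis using split[of x] split[of y] by (simp add: k_def s_def l_def r_def)
    qed
    have dT: "m k r - m l s \<in> T" using mT subspace_T by (rule_tac subspace_diff)
    have "kp (br x y) = br k l" "co (br x y) = co (m k r) - co (m l s)"
      unfolding eq using kp_eq[OF br_K[OF kl(1,2)] dT] by (simp_all add: co_lin)
    moreover have "co (m k r) = \<theta> k *\<^sub>R co y + \<beta> (ji k) (co y)" "co (m l s) = \<theta> l *\<^sub>R co x + \<beta> (ji l) (co x)"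
      using kl ji by (auto simp: m_def co_lin \<beta>_def r_def s_def co_vec co_in)
    ultimately show ?thesis
      using kl ji ji_br by (simp add: \<phi>_def semidirect_bracket_def flip: k_def l_def)
  qed
  have "bij_betw \<phi> L (Kc \<times> euclid n)"
  proof (rule bij_betw_byWitness[where f'="\<lambda>(a, v). j a + vec v"])
    show "\<forall>x\<in>L. (case \<phi> x of (a, v) \<Rightarrow> j a + vec v) = x"
      using kpK ji split by (auto simp: \<phi>_def)
    show "\<forall>p\<in>Kc \<times> euclid n. \<phi> (case p of (a, v) \<Rightarrow> j a + vec v) = p"
      using kp_eq jK vecT ij co_vec by (auto simp: \<phi>_def)
    show "\<phi> ` L \<subseteq> Kc \<times> euclid n" using kpK ji co_in by (auto simp: \<phi>_def)
    show "(\<lambda>(a, v). j a + vec v) ` (Kc \<times> euclid n) \<subseteq> L"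
      using jL vecT T_subset subspace_V by (auto intro!: subspace_add)
  qed
  moreover have "linear_on L \<phi>"
  proof -
    have "kp (x + y) = kp x + kp y" "kp (c *\<^sub>R x) = c *\<^sub>R kp x" for x y c
      by (simp_all add: kp_def co_lin vec_lin scaleR_diff_right)
    then show ?thesis using kpK by (simp add: linear_on_def \<phi>_def co_lin ji_add ji_scale)
  qed
  ultimately have "lie_isomorphism L brk (Kc \<times> euclid n)
      (semidirect_bracket brkK (\<lambda>a v. \<theta> (j a) *\<^sub>R v + \<beta> a v)) \<phi>"
    using hom agree by (simp add: lie_isomorphism_def)
  moreover have "g0 x y = g (j (fst (\<phi> x))) (j (fst (\<phi> y))) + euclid_inner n (snd (\<phi> x)) (snd (\<phi> y))"
    if x: "x \<in> L" and y: "y \<in> L" for x y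
  proof -
    have kt: "g k u = 0" "g u k = 0" if "k \<in> K" "u \<in> T" for k u
      using that g_sym[of u k] by (auto simp: K_def)
    have "g x y = g (kp x + vec (co x)) (kp y + vec (co y))" using split by simp
    also have "\<dots> = g (kp x) (kp y) + g (vec (co x)) (vec (co y))"
      using kt kpK x y vecT by (simp add: g_simps)
    also have "g (vec (co x)) (vec (co y)) = euclid_inner n (co (vec (co x))) (co (vec (co y)))"
      by (simp add: inner_co vecT)
    finally show ?thesis using agree x y ji kpK by (simp add: \<phi>_def co_vec co_in)
  qed
  moreover have "\<theta>0 x = \<theta> (j (fst (\<phi> x)))" if x: "x \<in> L" for x
  proof -
    have "\<theta> x = \<theta> (kp x + vec (co x))" using split by simp
    also have "\<dots> = \<theta> (kp x)" using vecT by (simp add: theta_simps T_def)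
    finally show ?thesis using agree x ji kpK by (simp add: \<phi>_def)
  qed
  ultimately have "semidirect_model L brk g0 \<theta>0 Kc brkK (\<lambda>a b. g (j a) (j b)) (\<lambda>a. \<theta> (j a)) n \<beta> \<phi>"
    unfolding semidirect_model_def by blast
  with rep show ?thesis by blast
qed

text \<open>A standard abelian structure leaves the inner product and the nonzero form free, so
  pulling both back along the coordinates of \<open>b\<close> is enough.\<close>

lemma abelian_model:
  assumes p: "p \<in> {1, 2}" and b: "\<And>i. i < p \<Longrightarrow> b i \<in> K" "\<exists>i<p. \<theta> (b i) \<noteq> 0"
    and indep: "\<And>f. (\<Sum>i<p. f i *\<^sub>R b i) = 0 \<Longrightarrow> \<forall>i<p. f i = (0::real)"
    and span: "\<And>v. v \<in> K \<Longrightarrow> \<exists>f. v = (\<Sum>i<p. f i *\<^sub>R b i)"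
    and com: "\<And>i k. i < p \<Longrightarrow> k < p \<Longrightarrow> br (b i) (b k) = 0"
    and agree: "\<And>x y. x \<in> L \<Longrightarrow> y \<in> L \<Longrightarrow> brk x y = br x y"
      "\<And>x y. x \<in> L \<Longrightarrow> y \<in> L \<Longrightarrow> g0 x y = g x y" "\<And>x. x \<in> L \<Longrightarrow> \<theta>0 x = \<theta> x"
  shows "\<exists>gK \<theta>K. standard_abelian_LCP p gK \<theta>K \<and>
            (\<exists>n \<beta> \<phi>. orthogonal_representation (euclid p) abelian_bracket n \<beta> \<and>
               semidirect_model L brk g0 \<theta>0 (euclid p) abelian_bracket gK \<theta>K n \<beta> \<phi>)"
proof -
  define j where "j v = (\<Sum>i<p. Poly_Mapping.lookup v i *\<^sub>R b i)" for v :: "nat \<Rightarrow>\<^sub>0 real"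
  have j_add: "j (v + w) = j v + j w" and j_scale: "j (c *\<^sub>R v) = c *\<^sub>R j v" for v w c
    by (simp_all add: j_def lookup_add lookup_scaleR scaleR_add_left sum.distrib scaleR_sum_right)
  have j0: "j 0 = 0" by (simp add: j_def)
  have lin: "linear_on (euclid p) j" by (simp add: linear_on_def j_add j_scale)
  have jK: "j v \<in> K" for v
    unfolding j_def using b subspace_K by (intro subspace_sum subspace_scale) auto
  have inj: "inj_on j (euclid p)"
  proof (rule inj_onI)
    fix v w assume v: "v \<in> euclid p" and w: "w \<in> euclid p" and "j v = j w"
    then have "(\<Sum>i<p. (Poly_Mapping.lookup v i - Poly_Mapping.lookup w i) *\<^sub>R b i) = 0"
      by (simp add: j_def scaleR_diff_left sum_subtractf)
    then have "\<forall>i<p. Poly_Mapping.lookup v i = Poly_Mapping.lookup w i"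
      using indep[of "\<lambda>i. Poly_Mapping.lookup v i - Poly_Mapping.lookup w i"] by simp
    then have "evec p (Poly_Mapping.lookup v) = evec p (Poly_Mapping.lookup w)"
      by (intro poly_mapping_eqI) (simp add: lookup_evec)
    then show "v = w" using evec_lookup v w by metis
  qed
  have j_evec: "j (evec p f) = (\<Sum>i<p. f i *\<^sub>R b i)" for f
    by (simp add: j_def lookup_evec)
  have "K \<subseteq> j ` euclid p"
  proof
    fix v assume "v \<in> K"
    then obtain f where "v = j (evec p f)" using span j_evec by metis
    then show "v \<in> j ` euclid p" using evec_in by blast
  qed
  then have im: "j ` euclid p = K" using jK by auto
  have br0: "br (j v) (j w) = 0" for v w
  proof -
    have "br x (j w) = 0" if "\<And>k. k < p \<Longrightarrow> br x (b k) = 0" for x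
      using that by (simp add: j_def linear_sum[OF br_linear] br_simps)
    moreover have "br (j v) (b k) = 0" if "k < p" for k
      using com that by (simp add: j_def linear_sum[OF br_linear'] br_simps)
    ultimately show ?thesis by blast
  qed
  have "\<exists>v\<in>euclid p. \<theta> (j v) \<noteq> 0"
  proof -
    obtain i where i: "i < p" "\<theta> (b i) \<noteq> 0" using b by blast
    obtain v where "v \<in> euclid p" "j v = b i" using im b(1)[OF i(1)] by (metis imageE)
    then show ?thesis using i by metis
  qed
  then have "standard_abelian_LCP p (\<lambda>v w. g (j v) (j w)) (\<lambda>v. \<theta> (j v))"
    using p inner_product_on_pullback[OF subspace_euclid lin inj, of K g] im Kg.inner_space_axioms
    by (simp add: standard_abelian_LCP_def linear_on_def j_add j_scale theta_simps)
  moreover have "\<exists>n \<beta> \<phi>. orthogonal_representation (euclid p) abelian_bracket n \<beta> \<and>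
      semidirect_model L brk g0 \<theta>0 (euclid p) abelian_bracket (\<lambda>v w. g (j v) (j w)) (\<lambda>v. \<theta> (j v)) n \<beta> \<phi>"
    using inj im br0 subspace_0[OF subspace_euclid] agree lin
    by (intro semidirect_model_exists subspace_euclid)
       (auto simp: bij_betw_def abelian_bracket_def j0)
  ultimately show ?thesis by blast
qed

text \<open>The map \<open>j\<close> sends the cross-product basis of su(2) to \<open>x\<close>,
  \<open>y\<close>, \<open>w\<close> and the central unit to \<open>s\<close>. By
  \<open>round_metric\<close> the metric on \<open>H\<close> is \<open>E / 4\<close> times the dot
  product; the remaining values \<open>g s\<close> on \<open>H\<close> and \<open>g s s\<close> come
  from expressing \<open>s\<close> through the dual vector of \<theta>.\<close>

lemma su2_model:
  assumes e: "e \<in> K" "\<And>x. x \<in> K \<Longrightarrow> m x e = x"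
    and s: "s \<in> K" "\<theta> s = 1" "\<And>x. x \<in> K \<Longrightarrow> br s x = 0"
    and H: "x \<in> H" "y \<in> H" "w \<in> H" "x \<noteq> 0" "y \<noteq> 0" "w \<noteq> 0"
    and br: "br x y = w" "br y w = x" "br w x = y"
    and ortho: "g x y = 0" "g y w = 0" "g w x = 0"
    and span: "\<And>v. v \<in> H \<Longrightarrow> \<exists>a b c. v = a *\<^sub>R x + b *\<^sub>R y + c *\<^sub>R w"
    and agree: "\<And>x y. x \<in> L \<Longrightarrow> y \<in> L \<Longrightarrow> brk x y = br x y"
      "\<And>x y. x \<in> L \<Longrightarrow> y \<in> L \<Longrightarrow> g0 x y = g x y" "\<And>x. x \<in> L \<Longrightarrow> \<theta>0 x = \<theta> x"
  shows "\<exists>gK \<theta>K. standard_su2_R_LCP gK \<theta>K \<and>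
            (\<exists>n \<beta> \<phi>. orthogonal_representation su2_R su2_R_bracket n \<beta> \<and>
               semidirect_model L brk g0 \<theta>0 su2_R su2_R_bracket gK \<theta>K n \<beta> \<phi>)"
proof -
  define E where "E = g e e"
  note round = round_metric[OF e H br ortho span, folded E_def]
  have E: "E > 0" using round(1) Kg.g_pos[of x] H H_simps by auto
  have th: "\<theta> x = 0" "\<theta> y = 0" "\<theta> w = 0" using H H_simps by auto
  have KK: "x \<in> K" "y \<in> K" "w \<in> K" using H H_simps by auto
  have ortho': "g y x = 0" "g w y = 0" "g x w = 0" using ortho g_sym by auto
  have br': "br y x = - w" "br w y = - x" "br x w = - y" using br br_anti by metis+
  have brs: "br v s = 0" if "v \<in> K" for v using s(3)[OF that] br_anti[of v s] by simp
  define j0 where "j0 M = su2_coord 0 M *\<^sub>R x + su2_coord 1 M *\<^sub>R y + su2_coord 2 M *\<^sub>R w" for M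
  define j where "j p = j0 (fst p) + snd p *\<^sub>R s" for p
  have j0_mat: "j0 (su2_mat a b c) = a *\<^sub>R x + b *\<^sub>R y + c *\<^sub>R w" for a b c
    by (simp add: j0_def su2_coord_mat)
  have j0H: "j0 M \<in> H" for M using H by (simp add: j0_def H_simps)
  have j0K: "j0 M \<in> K" "\<theta> (j0 M) = 0" for M using j0H[of M] by (simp_all add: H_simps)
  have j0_lin: "j0 (M + N) = j0 M + j0 N" "j0 (c *\<^sub>R M) = c *\<^sub>R j0 M" for M N c
    by (simp_all add: j0_def linear_add[OF linear_su2_coord] linear_scale[OF linear_su2_coord] algebra_simps)
  have g_j0: "g (j0 (su2_mat a b c)) (j0 (su2_mat a' b' c')) = (a * a' + b * b' + c * c') * E / 4"
    for a b c a' b' c'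
    by (simp add: j0_mat g_simps ortho ortho' round algebra_simps)
  have j_lin: "j (p + q) = j p + j q" "j (c *\<^sub>R p) = c *\<^sub>R j p" for p q c
    by (simp_all add: j_def j0_lin algebra_simps)
  have lin: "linear_on su2_R j" by (simp add: linear_on_def j_lin)
  have jK: "j p \<in> K" for p using s j0K by (simp add: j_def K_simps)
  have theta_j: "\<theta> (j p) = snd p" for p using s j0K by (simp add: j_def theta_simps)
  have sub: "subspace su2_R"
    using subspace_su2 by (auto simp: subspace_def su2_R_def zero_prod_def)
  have inj: "inj_on j su2_R"
  proof (rule inj_onI)
    fix p q assume p: "p \<in> su2_R" and q: "q \<in> su2_R" and eq: "j p = j q"
    have snd: "snd p = snd q" using theta_j eq by metis
    obtain a b c a' b' c' where abc: "fst p = su2_mat a b c" "fst q = su2_mat a' b' c'"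
      using p q by (auto simp: su2_R_def elim!: su2E)
    have "j0 (su2_mat (a - a') (b - b') (c - c')) = 0"
      using eq snd abc by (simp add: j_def j0_mat algebra_simps)
    then have "((a - a') * (a - a') + (b - b') * (b - b') + (c - c') * (c - c')) * E / 4 = 0"
      using g_j0[of "a - a'" "b - b'" "c - c'" "a - a'" "b - b'" "c - c'"] by (simp add: g_simps)
    then have "(a - a')\<^sup>2 + (b - b')\<^sup>2 + (c - c')\<^sup>2 = 0" using E by (simp add: power2_eq_square)
    then have "a = a'" "b = b'" "c = c'" by (simp_all add: add_nonneg_eq_0_iff)
    then show "p = q" using snd abc by (simp add: prod_eq_iff)
  qed
  have H_im: "\<exists>M\<in>su2. v = j0 M" if v: "v \<in> H" for v
    using span[OF v] j0_mat su2_mat_in by metis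
  have "K \<subseteq> j ` su2_R"
  proof
    fix v assume v: "v \<in> K"
    then have "v - \<theta> v *\<^sub>R s \<in> H" using s by (simp add: H_def K_simps theta_simps)
    then obtain M where "M \<in> su2" "v - \<theta> v *\<^sub>R s = j0 M" using H_im by blast
    then have "v = j (M, \<theta> v)" "(M, \<theta> v) \<in> su2_R" by (auto simp: j_def su2_R_def algebra_simps)
    then show "v \<in> j ` su2_R" by blast
  qed
  then have im: "j ` su2_R = K" using jK by auto
  have su2_R_br: "su2_R_bracket p q \<in> su2_R \<and> j (su2_R_bracket p q) = br (j p) (j q)"
    if p: "p \<in> su2_R" and q: "q \<in> su2_R" for p q
  proof -
    obtain a b c t a' b' c' t' where pq: "p = (su2_mat a b c, t)" "q = (su2_mat a' b' c', t')"
      using p q by (cases p; cases q) (auto simp: su2_R_def elim!: su2E)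
    have "br (j p) (j q) = br (j0 (su2_mat a b c)) (j0 (su2_mat a' b' c'))"
      using s(3) brs j0K s(1) by (simp add: pq j_def br_simps br_self)
    also have "\<dots> = j0 (commutator (su2_mat a b c) (su2_mat a' b' c'))"
      by (simp add: j0_mat commutator_su2_mat br_simps br br' br_self algebra_simps)
    finally show ?thesis
      by (simp add: pq su2_R_bracket_def j_def commutator_su2_mat su2_R_def su2_mat_in)
  qed
  \<comment> \<open>The \<open>g\<close>-dual vector of \<theta> within \<open>K\<close>, by
    \<open>theta_unit\<close>.\<close>
  define u where "u = (1 / E) *\<^sub>R e"
  have te: "\<theta> e = 1" using theta_unit[OF e(2) e(1)] E by (simp add: E_def)
  have gu: "g u v = \<theta> v" if "v \<in> K" for v
    using theta_unit[OF e(2) that] E g_sym[of v e] by (simp add: u_def g_simps E_def)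
  have uK: "u \<in> K" and tu: "\<theta> u = 1 / E" using e te by (auto simp: u_def K_simps theta_simps)
  \<comment> \<open>Since \<open>\<theta> u = 1 / E\<close> and \<open>\<theta> s = 1\<close>, the
    difference has no \<theta>-part. This is the required form of the dual vector, with
    \<open>lam = 1 / E\<close> and \<open>x0\<close> as its su(2) part.\<close>
  have "u - (1 / E) *\<^sub>R s \<in> H" using uK tu s by (simp add: H_def K_simps theta_simps)
  then obtain x0 where x0: "x0 \<in> su2" "u - (1 / E) *\<^sub>R s = j0 x0" using H_im by blast
  then have s_eq: "s = E *\<^sub>R (u - j0 x0)" using E by (simp add: algebra_simps eq_diff_eq')
  have kappa: "killing_form su2 commutator M N * (E / 8) = - g (j0 M) (j0 N)"
    if M: "M \<in> su2" and N: "N \<in> su2" for M N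
  proof -
    obtain a b c a' b' c' where MN: "M = su2_mat a b c" "N = su2_mat a' b' c'"
      using su2E[OF M] su2E[OF N] by metis
    show ?thesis unfolding MN killing_form_su2 g_j0 by (simp add: field_simps)
  qed
  have g_s: "g s (j0 M) = - E * g (j0 x0) (j0 M)" for M
    using gu[OF j0K(1)] j0K(2) by (simp add: s_eq g_simps)
  have g_ss: "g s s = E\<^sup>2 * (1 / E + g (j0 x0) (j0 x0))"
  proof -
    have "g s s = E * (g u s - g (j0 x0) s)" using s_eq by (metis g_scale' g_diff')
    also have "g u s = 1" using gu s by simp
    also have "g (j0 x0) s = - E * g (j0 x0) (j0 x0)" using g_s g_sym by metis
    finally show ?thesis using E by (simp add: power2_eq_square algebra_simps)
  qed
  let ?gK = "\<lambda>p q. g (j p) (j q)" and ?\<theta>K = "\<lambda>p. \<theta> (j p)"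
  let ?\<kappa> = "killing_form su2 commutator"
  have "standard_su2_R_LCP ?gK ?\<theta>K"
    unfolding standard_su2_R_LCP_def Let_def
  proof (rule exI[of _ "(0, 1)"], rule exI[of _ "E / 8"], rule exI[of _ "1 / E"],
      rule bexI[of _ x0], intro conjI ballI)
    show "lie_center su2_R su2_R_bracket = span {(0, 1)}"
      by (rule lie_center_su2_R)
    show "E / 8 > 0" "1 / E \<noteq> 0" using E by auto
    show "inner_product_on su2_R ?gK"
      using inner_product_on_pullback[OF sub lin inj _ Kg.inner_space_axioms] im by simp
    have j1: "j (0, 1) = s" by (simp add: j_def j0_def linear_0[OF linear_su2_coord])
    have jM: "j (M, 0) = j0 M" for M by (simp add: j_def)
    show "g (j (M, 0)) (j (N, 0)) = - (E / 8) * ?\<kappa> M N" if "M \<in> su2" "N \<in> su2" for M N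
      using kappa[OF that] by (simp only: jM mult_minus_left mult.commute[of "E / 8"] minus_minus)
    show "g (j (0, 1)) (j (M, 0)) = E / 8 / (1 / E) * ?\<kappa> x0 M" if "M \<in> su2" for M
      using kappa[OF x0(1) that] g_s[of M] by (simp add: j1 jM algebra_simps)
    show "g (j (0, 1)) (j (0, 1)) = 1 / (1 / E)\<^sup>2 * (1 / (8 * (E / 8)) - E / 8 * ?\<kappa> x0 x0)"
      using kappa[OF x0(1) x0(1)] by (simp add: j1 g_ss power_divide algebra_simps)
    show "\<theta> (j v) = g (j ((1 / E) *\<^sub>R (0, 1) + (x0, 0))) (j v)" if "v \<in> su2_R" for v
    proof -
      have "j ((1 / E) *\<^sub>R (0, 1) + (x0, 0)) = u"
        unfolding j_lin j1 jM x0(2)[symmetric] by simp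
      then show ?thesis using gu jK by simp
    qed
    show "x0 \<in> su2" by fact
  qed
  moreover have "\<exists>n \<beta> \<phi>. orthogonal_representation su2_R su2_R_bracket n \<beta> \<and>
      semidirect_model L brk g0 \<theta>0 su2_R su2_R_bracket ?gK ?\<theta>K n \<beta> \<phi>"
    using inj im su2_R_br agree lin
    by (intro semidirect_model_exists sub) (auto simp: bij_betw_def)
  ultimately show ?thesis by blast
qed

text \<open>The data \<open>brk\<close>, \<open>g0\<close>, \<open>\<theta>0\<close> are separate
  from those of the locale because the originals agree with the extensions to the whole type only on
  \<open>L\<close>.\<close>

theorem flat_similarity_structure:
  assumes agree: "\<And>x y. x \<in> L \<Longrightarrow> y \<in> L \<Longrightarrow> brk x y = br x y"
      "\<And>x y. x \<in> L \<Longrightarrow> y \<in> L \<Longrightarrow> g0 x y = g x y" "\<And>x. x \<in> L \<Longrightarrow> \<theta>0 x = \<theta> x"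
  shows "(\<exists>p\<in>{1, 2}. \<exists>gK \<theta>K. standard_abelian_LCP p gK \<theta>K \<and>
            (\<exists>n \<beta> \<phi>. orthogonal_representation (euclid p) abelian_bracket n \<beta> \<and>
               semidirect_model L brk g0 \<theta>0 (euclid p) abelian_bracket gK \<theta>K n \<beta> \<phi>)) \<or>
         (\<exists>gK \<theta>K. standard_su2_R_LCP gK \<theta>K \<and>
            (\<exists>n \<beta> \<phi>. orthogonal_representation su2_R su2_R_bracket n \<beta> \<and>
               semidirect_model L brk g0 \<theta>0 su2_R su2_R_bracket gK \<theta>K n \<beta> \<phi>))"
proof -
  obtain s where s: "s \<in> K" "\<theta> s = 1" "\<And>x. x \<in> K \<Longrightarrow> br s x = 0" using central_element by blast
  have s0: "s \<noteq> 0" using s by (auto simp: theta_simps)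
  have dec: "v - \<theta> v *\<^sub>R s \<in> H" if "v \<in> K" for v
    using that s by (simp add: H_def K_simps theta_simps)
  show ?thesis
  proof (cases rule: kernel_classification)
    case zero
    have "\<exists>f. v = (\<Sum>i<1::nat. f i *\<^sub>R s)" if "v \<in> K" for v
      using dec[OF that] zero by (intro exI[of _ "\<lambda>i. \<theta> v"]) (simp add: lessThan_Suc)
    then show ?thesis
      using abelian_model[of 1 "\<lambda>_. s" brk g0 \<theta>0] s s0 agree by (auto simp: br_self)
  next
    case (line x)
    define b where "b i = (if i = 0 then s else x)" for i :: nat
    have sum2: "(\<Sum>i<2. f i *\<^sub>R b i) = f 0 *\<^sub>R s + f 1 *\<^sub>R x" for f
      by (simp add: b_def numeral_2_eq_2)
    have xK: "x \<in> K" "\<theta> x = 0" using line H_simps by auto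
    have b_span: "\<exists>f. v = (\<Sum>i<2. f i *\<^sub>R b i)" if v: "v \<in> K" for v
    proof -
      obtain a where "v - \<theta> v *\<^sub>R s = a *\<^sub>R x" using line(3)[OF dec[OF v]] by blast
      then show ?thesis
        unfolding sum2 by (intro exI[of _ "\<lambda>i. if i = 0 then \<theta> v else a"]) (simp add: algebra_simps)
    qed
    have b_indep: "\<forall>i<2. f i = 0" if "(\<Sum>i<2. f i *\<^sub>R b i) = 0" for f
    proof -
      have *: "f 0 *\<^sub>R s + f 1 *\<^sub>R x = 0" using that sum2 by simp
      then have "\<theta> (f 0 *\<^sub>R s + f 1 *\<^sub>R x) = 0" by (simp add: theta_simps)
      then have "f 0 = 0" using s xK by (simp add: theta_simps)
      with * line show ?thesis by (auto simp: less_2_cases_iff)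
    qed
    have b_com: "br (b i) (b k) = 0" for i k
      using s(3)[OF xK(1)] br_anti[of x s] by (simp add: b_def br_self)
    have b_K: "b i \<in> K" "\<theta> (b 0) \<noteq> 0" for i using s xK by (simp_all add: b_def)
    have "\<exists>i<2. \<theta> (b i) \<noteq> 0" using b_K(2) by (intro exI[of _ 0]) simp
    note model = abelian_model[OF _ b_K(1) this b_indep b_span b_com agree]
    show ?thesis by (rule disjI1, rule bexI[of _ 2], rule model) auto
  next
    case (su2 x y w)
    obtain e where e: "e \<in> K" "\<And>x. x \<in> K \<Longrightarrow> m x e = x" using right_unit by blast
    show ?thesis
      by (intro disjI2 su2_model[OF e s su2 agree])
  qed
qed

end

section \<open>From a conformally flat LCP structure to affine similarities\<close>

lemma linear_on_imp_linear:
  assumes "linear_on L f" "linear p" "\<And>x. p x \<in> L"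
  shows "linear (\<lambda>x. f (p x))"
  using assms by (intro linearI) (auto simp: linear_on_def linear_add linear_scale)

lemma subspace_projector:
  assumes "subspace L"
  obtains p where "linear p" "\<And>x. p x \<in> L" "\<And>x. x \<in> L \<Longrightarrow> p x = (x::'a::real_vector)"
proof -
  obtain C where C: "C \<subseteq> L" "independent C" "L \<subseteq> span C"
    using maximal_independent_subset by blast
  then have L: "span C = L" using assms by (simp add: span_minimal subset_antisym)
  obtain p where p: "linear p" "\<forall>x\<in>C. p x = id x" "range p = span (id ` C)"
    using linear_independent_extend_subspace[OF C(2), of id] by blast
  have "p x = x" if "x \<in> L" for x
    using linear_eq_on[OF p(1) linear_id, of x C] p(2) that L by (simp add: id_def)
  then show ?thesis using that[of p] p L by auto
qed

lemma dual_vector_inner: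
  assumes "inner_space L g'" and g: "\<And>x y. x \<in> L \<Longrightarrow> y \<in> L \<Longrightarrow> g' x y = g x y"
    and p: "linear p" "\<And>x. p x \<in> L" "\<And>x. x \<in> L \<Longrightarrow> p x = x" and \<alpha>: "linear_on L \<alpha>"
  shows "dual_vector L g \<alpha> \<in> L \<and> (\<forall>z\<in>L. g (dual_vector L g \<alpha>) z = \<alpha> z)"
proof -
  interpret inner_space L g' by fact
  obtain w where w: "w \<in> L" "\<And>z. z \<in> L \<Longrightarrow> g' w z = \<alpha> (p z)"
    using riesz[OF subspace_V order_refl linear_on_imp_linear[OF \<alpha> p(1,2)]] by blast
  show ?thesis
    unfolding dual_vector_def
  proof (rule theI)
    show "w \<in> L \<and> (\<forall>z\<in>L. g w z = \<alpha> z)" using w p(3) g by auto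
    show "v = w" if "v \<in> L \<and> (\<forall>z\<in>L. g v z = \<alpha> z)" for v
      using that w p(3) g by (intro g_eqI) auto
  qed
qed

text \<open>Subtracting \<open>\<theta> x\<close> times the identity from the Weyl connection leaves
  a skew map: the Levi-Civita part is skew, and the other two terms are exchanged with a sign under
  the metric. The terms added to Levi-Civita are symmetric in \<open>x\<close> and \<open>y\<close>,
  so the torsion stays zero. Closedness of \<theta> lets flatness pass from \<open>W\<close> to
  \<open>A\<close>.\<close>

lemma conformally_flat_imp_flat_similarity:
  fixes L :: "'a::real_vector set"
  assumes "lie_algebra L brk" and flat: "conformally_flat_LCP L brk g \<theta>"
  obtains g' \<theta>' A where "flat_similarity L g' \<theta>' A"
    "\<And>x y. x \<in> L \<Longrightarrow> y \<in> L \<Longrightarrow> brk x y = flat_similarity.br \<theta>' A x y"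
    "\<And>x y. x \<in> L \<Longrightarrow> y \<in> L \<Longrightarrow> g x y = g' x y" "\<And>x. x \<in> L \<Longrightarrow> \<theta> x = \<theta>' x"
proof -
  interpret lie_algebra L brk by fact
  define W where "W = weyl_connection L brk g \<theta>"
  have ip: "inner_product_on L g" and closed: "closed_form L brk \<theta>" and nz: "\<exists>x\<in>L. \<theta> x \<noteq> 0"
    and rep: "lie_representation L brk L W"
    using flat by (auto simp: conformally_flat_LCP_def LCP_structure_def weyl_flat_def W_def)
  obtain p where p: "linear p" "\<And>x. p x \<in> L" "\<And>x. x \<in> L \<Longrightarrow> p x = x"
    using subspace_projector[OF subspace] by blast
  note p_lin = linear_add[OF p(1)] linear_diff[OF p(1)] linear_scale[OF p(1)]
  note L_simps = subspace_add[OF subspace] subspace_diff[OF subspace] subspace_scale[OF subspace]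
    bracket_closed p(2)
  have brk_simps: "x \<in> L \<Longrightarrow> y \<in> L \<Longrightarrow> z \<in> L \<Longrightarrow> brk x (y + z) = brk x y + brk x z"
    "x \<in> L \<Longrightarrow> y \<in> L \<Longrightarrow> brk x (c *\<^sub>R y) = c *\<^sub>R brk x y"
    "x \<in> L \<Longrightarrow> y \<in> L \<Longrightarrow> z \<in> L \<Longrightarrow> brk (y + z) x = brk y x + brk z x"
    "x \<in> L \<Longrightarrow> y \<in> L \<Longrightarrow> brk (c *\<^sub>R y) x = c *\<^sub>R brk y x" for x y z c
    using bracket_bilinear by (auto simp: bilinear_on_def linear_on_def)
  have brk_anti: "brk y x = - brk x y" if "x \<in> L" "y \<in> L" for x y
    using bracket_alternating[of "x + y"] bracket_alternating[of x] bracket_alternating[of y] that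
    by (simp add: brk_simps L_simps add_eq_0_iff2)
  have gsimps: "x \<in> L \<Longrightarrow> y \<in> L \<Longrightarrow> z \<in> L \<Longrightarrow> g x (y + z) = g x y + g x z"
    "x \<in> L \<Longrightarrow> y \<in> L \<Longrightarrow> g x (c *\<^sub>R y) = c * g x y"
    "x \<in> L \<Longrightarrow> y \<in> L \<Longrightarrow> z \<in> L \<Longrightarrow> g (y + z) x = g y x + g z x"
    "x \<in> L \<Longrightarrow> y \<in> L \<Longrightarrow> g (c *\<^sub>R y) x = c * g y x" for x y z c
    using ip by (auto simp: inner_product_on_def bilinear_on_def linear_on_def)
  have g_diff: "g (y - z) x = g y x - g z x" "g x (y - z) = g x y - g x z"
    if "x \<in> L" "y \<in> L" "z \<in> L" for x y z
    using gsimps(3)[of x "y - z" z] gsimps(1)[of x "y - z" z] that by (simp_all add: L_simps)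
  have gsym: "g x y = g y x" if "x \<in> L" "y \<in> L" for x y
    using ip that by (auto simp: inner_product_on_def)
  have th: "x \<in> L \<Longrightarrow> y \<in> L \<Longrightarrow> \<theta> (x + y) = \<theta> x + \<theta> y"
    "x \<in> L \<Longrightarrow> \<theta> (c *\<^sub>R x) = c * \<theta> x" for x y c
    using closed by (auto simp: closed_form_def linear_on_def)
  have th_brk: "\<theta> (brk x y) = 0" if "x \<in> L" "y \<in> L" for x y
    using closed that unfolding closed_form_def derived_algebra_def by (blast intro: span_base)
  have W_simps: "x \<in> L \<Longrightarrow> y \<in> L \<Longrightarrow> z \<in> L \<Longrightarrow> W x (y + z) = W x y + W x z"
    "x \<in> L \<Longrightarrow> y \<in> L \<Longrightarrow> W x (c *\<^sub>R y) = c *\<^sub>R W x y"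
    "x \<in> L \<Longrightarrow> y \<in> L \<Longrightarrow> z \<in> L \<Longrightarrow> W (y + z) x = W y x + W z x"
    "x \<in> L \<Longrightarrow> y \<in> L \<Longrightarrow> W (c *\<^sub>R y) x = c *\<^sub>R W y x" for x y z c
    using rep by (auto simp: lie_representation_def linear_on_def)
  have W_in: "W x y \<in> L" if "x \<in> L" "y \<in> L" for x y
    using rep that unfolding lie_representation_def by blast
  have W_brk: "W (brk x y) z = W x (W y z) - W y (W x z)" if "x \<in> L" "y \<in> L" "z \<in> L" for x y z
    using rep that by (simp add: lie_representation_def)
  define g' where "g' x y = g (p x) (p y)" for x y
  define \<theta>' where "\<theta>' x = \<theta> (p x)" for x
  define S where "S x y = W x y - \<theta> x *\<^sub>R y" for x y
  define A where "A x y = S (p x) (p y)" for x y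
  have g'_eq: "g' x y = g x y" if "x \<in> L" "y \<in> L" for x y using that p by (simp add: g'_def)
  have ips: "inner_space L g'"
  proof (intro inner_space.intro)
    show "\<exists>B. finite B \<and> span B = L" by (rule finite_dimensional)
    show "linear (g' x)" for x
      unfolding g'_def by (rule linearI) (simp_all add: p_lin gsimps p)
    show "g' x y = g' y x" for x y using gsym p by (simp add: g'_def)
    show "g' x x > 0" if "x \<in> L" "x \<noteq> 0" for x
      using that ip p by (auto simp: g'_def inner_product_on_def)
  qed
  then interpret I: inner_space L g' .
  have dual: "dual_vector L g \<alpha> \<in> L \<and> (\<forall>z\<in>L. g (dual_vector L g \<alpha>) z = \<alpha> z)"
    if "linear_on L \<alpha>" for \<alpha>
    by (rule dual_vector_inner[OF ips _ p that]) (rule g'_eq)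
  have W_inner: "g (W x y) z = 1/2 * (g (brk x y) z - g (brk x z) y - g (brk y z) x)
      + \<theta> x * g y z + \<theta> y * g x z - g x y * \<theta> z"
    if x: "x \<in> L" and y: "y \<in> L" and z: "z \<in> L" for x y z
  proof -
    have "linear_on L (\<lambda>z. 1/2 * (g (brk x y) z - g (brk x z) y - g (brk y z) x))"
      unfolding linear_on_def
      using x y by (auto simp: brk_simps gsimps L_simps algebra_simps)
    note lc = dual[OF this, folded levi_civita_def]
    have "linear_on L \<theta>" using closed by (simp add: closed_form_def)
    note du = dual[OF this]
    show ?thesis
      unfolding W_def weyl_connection_def
      using lc du x y z by (simp add: g_diff gsimps L_simps)
  qed
  have S_in: "S x y \<in> L" if "x \<in> L" "y \<in> L" for x y
    using that W_in by (simp add: S_def L_simps)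
  have S_skew: "g (S x y) z = - g y (S x z)" if "x \<in> L" "y \<in> L" "z \<in> L" for x y z
  proof -
    have "g y (S x z) = g (S x z) y" using that S_in gsym by simp
    moreover have "g y z = g z y" "g x y = g y x" "g x z = g z x" using that gsym by auto
    moreover have "g (brk z y) x = - g (brk y z) x"
      using brk_anti[of y z] gsimps(4)[of x "brk y z" "-1"] that by (simp add: L_simps)
    ultimately show ?thesis
      using that by (simp add: S_def g_diff gsimps L_simps W_in W_inner algebra_simps)
  qed
  have torsion: "W x y - W y x = brk x y" if x: "x \<in> L" and y: "y \<in> L" for x y
  proof (rule I.g_eqI)
    fix z assume z: "z \<in> L"
    have "g (brk y x) z = - g (brk x y) z"
      using brk_anti[OF x y] gsimps(4)[of z "brk x y" "-1"] x y z by (simp add: L_simps)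
    then show "g' (W x y - W y x) z = g' (brk x y) z"
      using x y z gsym[OF x y] by (simp add: g'_eq g_diff L_simps W_in W_inner algebra_simps)
  qed (use x y W_in L_simps in auto)
  \<comment> \<open>For arbitrary arguments the product bracket need not lie in \<open>L\<close>,
    but \<open>\<theta>'\<close> and \<open>A\<close> see only its projection, which is a genuine
    bracket of \<open>L\<close>. This is why the axioms can hold on the whole type.\<close>
  have p_br: "p (\<theta>' x *\<^sub>R y + A x y - (\<theta>' y *\<^sub>R x + A y x)) = brk (p x) (p y)" for x y
    using torsion[of "p x" "p y"] p
    by (simp add: A_def \<theta>'_def p_lin S_in) (simp add: S_def)
  have fs: "flat_similarity L g' \<theta>' A"
  proof (intro flat_similarity.intro ips flat_similarity_axioms.intro)
    show "linear \<theta>'" by (rule linearI) (simp_all add: \<theta>'_def p_lin th p)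
    show "\<exists>x\<in>L. \<theta>' x \<noteq> 0" using nz p by (auto simp: \<theta>'_def)
    show "linear (A x)" for x
      by (rule linearI) (simp_all add: A_def S_def p_lin W_simps p algebra_simps)
    show "linear (\<lambda>x. A x y)" for y
      by (rule linearI) (simp_all add: A_def S_def p_lin W_simps th p algebra_simps)
    show "A x y \<in> L" for x y using S_in p by (simp add: A_def)
    show "g' (A x y) z = - g' y (A x z)" for x y z
      using S_skew p S_in by (simp add: A_def g'_def)
    show "\<theta>' (\<theta>' x *\<^sub>R y + A x y - (\<theta>' y *\<^sub>R x + A y x)) = 0" for x y
      unfolding \<theta>'_def[of "_ - _"] p_br using th_brk p by simp
    show "A (\<theta>' x *\<^sub>R y + A x y - (\<theta>' y *\<^sub>R x + A y x)) z = A x (A y z) - A y (A x z)" for x y z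
    proof -
      have Wd: "W a (b - c) = W a b - W a c" if "a \<in> L" "b \<in> L" "c \<in> L" for a b c
        using W_simps(1)[of a "b - c" c] that by (simp add: L_simps)
      have SS: "S a (S b c) = W a (W b c) - \<theta> b *\<^sub>R W a c - \<theta> a *\<^sub>R W b c + (\<theta> a * \<theta> b) *\<^sub>R c"
        if "a \<in> L" "b \<in> L" "c \<in> L" for a b c
        using that by (simp add: S_def Wd W_simps W_in L_simps algebra_simps)
      have "A (\<theta>' x *\<^sub>R y + A x y - (\<theta>' y *\<^sub>R x + A y x)) z = W (brk (p x) (p y)) (p z)"
        unfolding A_def[of "_ - _"] p_br using th_brk p by (simp add: S_def)
      also have "\<dots> = S (p x) (S (p y) (p z)) - S (p y) (S (p x) (p z))"
        using p by (simp add: W_brk SS)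
      finally show ?thesis using p S_in by (simp add: A_def)
    qed
  qed
  show ?thesis
  proof (rule that[OF fs])
    fix x y assume "x \<in> L" "y \<in> L"
    then show "brk x y = flat_similarity.br \<theta>' A x y"
      using torsion[of x y] p
      by (simp add: flat_similarity.br_def[OF fs] flat_similarity.m_def[OF fs] A_def \<theta>'_def S_def)
  qed (simp_all add: g'_eq \<theta>'_def p)
qed

theorem theorem3p10:
  fixes L :: "'a::real_vector set" and brk :: "'a \<Rightarrow> 'a \<Rightarrow> 'a"
    and g :: "'a \<Rightarrow> 'a \<Rightarrow> real" and \<theta> :: "'a \<Rightarrow> real"
  assumes "lie_algebra L brk"
    and "conformally_flat_LCP L brk g \<theta>"
  shows "(\<exists>p\<in>{1, 2}. \<exists>gK \<theta>K. standard_abelian_LCP p gK \<theta>K \<and>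
            (\<exists>n \<beta> \<phi>. orthogonal_representation (euclid p) abelian_bracket n \<beta> \<and>
               semidirect_model L brk g \<theta> (euclid p) abelian_bracket gK \<theta>K n \<beta> \<phi>)) \<or>
         (\<exists>gK \<theta>K. standard_su2_R_LCP gK \<theta>K \<and>
            (\<exists>n \<beta> \<phi>. orthogonal_representation su2_R su2_R_bracket n \<beta> \<and>
               semidirect_model L brk g \<theta> su2_R su2_R_bracket gK \<theta>K n \<beta> \<phi>))"
proof -
  obtain g' \<theta>' A where "flat_similarity L g' \<theta>' A"
    "\<And>x y. x \<in> L \<Longrightarrow> y \<in> L \<Longrightarrow> brk x y = flat_similarity.br \<theta>' A x y"
    "\<And>x y. x \<in> L \<Longrightarrow> y \<in> L \<Longrightarrow> g x y = g' x y" "\<And>x. x \<in> L \<Longrightarrow> \<theta> x = \<theta>' x"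
    by (rule conformally_flat_imp_flat_similarity[OF assms]) blast
  then show ?thesis by (rule flat_similarity.flat_similarity_structure)
qed

end
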